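(* Let $\alpha\in\mathcal R_c$ and let $X$ be a separable Banach space. If $f\in L^\alpha(\mathbb T,X)$ and $\{\phi_\lambda\}$ is an approximate identity in $L^1(\mathbb T)$, then: (1) $f\ast\phi_\lambda\in L^\alpha(\mathbb T,X)$ and $\alpha(f\ast\phi_\lambda)\le\alpha(f)$ for every $\lambda$; (2) $\lim_\lambda\alpha(f-f\ast\phi_\lambda)=0$.
   Context: $\mathbb T$ is the unit circle and $m$ is normalized arc length (Haar measure) on $\mathbb T$; functions equal a.e. are identified. For a function $f$ on $\mathbb T$ and $w\in\mathbb T$, $f_w(z)=f(\overline wz)$. $\mathcal R_c$ is the set of continuous rotationally symmetric seminorms, i.e. seminorms $\alpha$ on $L^\infty(\mathbb T)$ with $\alpha(1)=1$, $\alpha(|f|)=\alpha(f)$, $\alpha(f_w)=\alpha(f)$ for all $f\in L^\infty(\mathbb T)$, $w\in\mathbb T$, and $\lim_{m(E)\to0^+}\alpha(\chi_E)=0$. For any measurable $f:\mathbb T\to\mathbb C$ put $\alpha(f)=\sup\{\alpha(s):s\text{ a simple function},\ |s|\le|f|\}$. $\mathcal L^\alpha(\mathbb T)$ is the set of measurable $f$ with $\alpha(f)<\infty$, and $L^\alpha(\mathbb T)$ is the $\alpha$-closure of $L^\infty(\mathbb T)$ in $\mathcal L^\alpha(\mathbb T)$. For $f:\mathbb T\to X$ measurable, $|f|(z)=\|f(z)\|$ and $\alpha(f)=\alpha(|f|)$; $L^\alpha(\mathbb T,X)$ is the space (with norm $\alpha$) of measurable $f:\mathbb T\to X$ with $|f|\in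 L^\alpha(\mathbb T)$. For $g\in L^1(\mathbb T)$, $(f\ast g)(z)=\int_{\mathbb T}f(\overline wz)g(w)\,dm(w)$ for almost every $z$ (Bochner integral). An approximate identity in $L^1(\mathbb T)$ is a net $\{\phi_\lambda\}$ in $L^1(\mathbb T)$ such that: $\phi_\lambda\ge0$ for all $\lambda$; $\int_{\mathbb T}\phi_\lambda\,dm=1$ for all $\lambda$; and for every $E\subset\mathbb T$ that is the complement of an open neighborhood of $1$, $\phi_\lambda$ converges uniformly to $0$ on $E$. *)

theory Defs
  imports "HOL-Probability.Probability"
begin

text \<open>
  The circle \<open>\<bbbT>\<close> is \<^term>\<open>sphere (0::complex) 1\<close>. A function on \<open>\<bbbT>\<close> is a total function on
  \<^typ>\<open>complex\<close> of which only the values on the circle matter. Functions that agree almost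
  everywhere are identified, so pointwise conditions are imposed almost everywhere, and Borel
  measurable functions suffice as representatives.
\<close>

definition circle :: "complex measure" where
  "circle = distr (uniform_measure lborel {0..2 * pi}) (restrict_space borel (sphere 0 1)) cis"

lemma space_circle [simp]: "space circle = sphere 0 1"
  by (simp add: circle_def space_restrict_space)

lemma sets_circle: "sets circle = sets (restrict_space borel (sphere 0 1))"
  by (simp add: circle_def)

lemma prob_space_circle: "prob_space circle"
proof -
  have "prob_space (uniform_measure lborel {0..2 * pi})"
    by (rule prob_space_uniform_measure) auto
  moreover have "cis \<in> borel_measurable borel"
    by (intro borel_measurable_continuous_onI continuous_intros)
  then have "cis \<in> uniform_measure lborel {0..2 * pi} \<rightarrow>\<^sub>M restrict_space borel (sphere 0 1)"
    by (intro measurable_restrict_space2) (simp_all cong: measurable_cong_sets)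
  ultimately show ?thesis
    unfolding circle_def by (rule prob_space.prob_space_distr)
qed

definition Linfty :: "(complex \<Rightarrow> complex) set" where
  "Linfty = {f \<in> borel_measurable circle. \<exists>C. AE z in circle. norm (f z) \<le> C}"

text \<open>
  The set \<open>\<R>\<^sub>c\<close> of continuous rotationally symmetric seminorms. Values of \<open>\<alpha>\<close> outside
  \<^const>\<open>Linfty\<close> are irrelevant; the second conjunct says that \<open>\<alpha>\<close> is well defined on classes
  of functions that agree almost everywhere.
\<close>

definition Rc :: "((complex \<Rightarrow> complex) \<Rightarrow> real) set" where
  "Rc = {\<alpha>.
     (\<forall>f\<in>Linfty. 0 \<le> \<alpha> f) \<and>
     (\<forall>f\<in>Linfty. \<forall>g\<in>Linfty. (AE z in circle. f z = g z) \<longrightarrow> \<alpha> f = \<alpha> g) \<and>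
     (\<forall>f\<in>Linfty. \<forall>g\<in>Linfty. \<alpha> (\<lambda>z. f z + g z) \<le> \<alpha> f + \<alpha> g) \<and>
     (\<forall>f\<in>Linfty. \<forall>c. \<alpha> (\<lambda>z. c * f z) = norm c * \<alpha> f) \<and>
     \<alpha> (\<lambda>_. 1) = 1 \<and>
     (\<forall>f\<in>Linfty. \<alpha> (\<lambda>z. complex_of_real (norm (f z))) = \<alpha> f) \<and>
     (\<forall>f\<in>Linfty. \<forall>w\<in>sphere 0 1. \<alpha> (\<lambda>z. f (cnj w * z)) = \<alpha> f) \<and>
     (\<forall>e>0. \<exists>d>0. \<forall>E\<in>sets circle.
        0 < measure circle E \<and> measure circle E < d \<longrightarrow> \<alpha> (indicator E) < e)}"

definition ext :: "((complex \<Rightarrow> complex) \<Rightarrow> real) \<Rightarrow> (complex \<Rightarrow> complex) \<Rightarrow> ennreal" where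
  "ext \<alpha> f = (SUP s \<in> {s. simple_function circle s \<and> (AE z in circle. norm (s z) \<le> norm (f z))}.
     ennreal (\<alpha> s))"

definition Lfin :: "((complex \<Rightarrow> complex) \<Rightarrow> real) \<Rightarrow> (complex \<Rightarrow> complex) set" where
  "Lfin \<alpha> = {f \<in> borel_measurable circle. ext \<alpha> f < \<infinity>}"

text \<open>\<open>L\<^sup>\<alpha>(\<bbbT>)\<close>, the \<open>\<alpha>\<close>-closure of \<^const>\<open>Linfty\<close> in \<^const>\<open>Lfin\<close>.\<close>

definition Lalpha :: "((complex \<Rightarrow> complex) \<Rightarrow> real) \<Rightarrow> (complex \<Rightarrow> complex) set" where
  "Lalpha \<alpha> = {f \<in> Lfin \<alpha>. \<forall>e>0. \<exists>g\<in>Linfty. ext \<alpha> (\<lambda>z. f z - g z) < ennreal e}"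

definition vnorm ::
  "((complex \<Rightarrow> complex) \<Rightarrow> real) \<Rightarrow> (complex \<Rightarrow> 'a::real_normed_vector) \<Rightarrow> ennreal" where
  "vnorm \<alpha> f = ext \<alpha> (\<lambda>z. complex_of_real (norm (f z)))"

definition Lalpha_vec ::
  "((complex \<Rightarrow> complex) \<Rightarrow> real) \<Rightarrow> (complex \<Rightarrow> 'a::real_normed_vector) set" where
  "Lalpha_vec \<alpha> =
     {f \<in> borel_measurable circle. (\<lambda>z. complex_of_real (norm (f z))) \<in> Lalpha \<alpha>}"

text \<open>
  Only real kernels are needed, so real scalars suffice; a complex Banach space is covered
  through its underlying real Banach space. The Bochner integral has the default value 0 where
  it does not exist; \<open>conv_exists\<close> states that this happens only on a null set.
\<close>

definition conv ::
  "(complex \<Rightarrow> 'a) \<Rightarrow> (complex \<Rightarrow> real) \<Rightarrow> complex \<Rightarrow> 'a::{banach, second_countable_topology}"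
  where "conv f g z = (LINT w|circle. g w *\<^sub>R f (cnj w * z))"

definition conv_exists ::
  "(complex \<Rightarrow> 'a::{banach, second_countable_topology}) \<Rightarrow> (complex \<Rightarrow> real) \<Rightarrow> bool" where
  "conv_exists f g \<longleftrightarrow> (AE z in circle. integrable circle (\<lambda>w. g w *\<^sub>R f (cnj w * z)))"

definition directed_on :: "'i set \<Rightarrow> ('i \<Rightarrow> 'i \<Rightarrow> bool) \<Rightarrow> bool" where
  "directed_on I le \<longleftrightarrow> I \<noteq> {} \<and> (\<forall>a\<in>I. le a a) \<and>
     (\<forall>a\<in>I. \<forall>b\<in>I. \<forall>c\<in>I. le a b \<longrightarrow> le b c \<longrightarrow> le a c) \<and>
     (\<forall>a\<in>I. \<forall>b\<in>I. \<exists>c\<in>I. le a c \<and> le b c)"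

text \<open>The filter of tails: limits along it are limits of nets indexed by the directed set.\<close>

definition net_filter :: "'i set \<Rightarrow> ('i \<Rightarrow> 'i \<Rightarrow> bool) \<Rightarrow> 'i filter" where
  "net_filter I le = (INF a\<in>I. principal {l\<in>I. le a l})"

lemma eventually_net_filter:
  assumes "directed_on I le"
  shows "eventually P (net_filter I le) \<longleftrightarrow> (\<exists>a\<in>I. \<forall>l\<in>I. le a l \<longrightarrow> P l)"
proof -
  have "\<exists>c\<in>I. principal {l\<in>I. le c l} \<le> inf (principal {l\<in>I. le a l}) (principal {l\<in>I. le b l})"
    if ab: "a \<in> I" "b \<in> I" for a b
  proof -
    obtain c where c: "c \<in> I" "le a c" "le b c"
      using assms ab unfolding directed_on_def by blast
    have "{l\<in>I. le c l} \<subseteq> {l\<in>I. le a l} \<inter> {l\<in>I. le b l}"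
      using assms ab c unfolding directed_on_def by blast
    then show ?thesis using c(1) by auto
  qed
  moreover have "I \<noteq> {}" using assms by (simp add: directed_on_def)
  ultimately have "eventually P (net_filter I le) \<longleftrightarrow>
      (\<exists>a\<in>I. eventually P (principal {l\<in>I. le a l}))"
    unfolding net_filter_def by (intro eventually_INF_base) auto
  then show ?thesis by (auto simp: eventually_principal)
qed

definition approximate_identity ::
  "'i set \<Rightarrow> ('i \<Rightarrow> 'i \<Rightarrow> bool) \<Rightarrow> ('i \<Rightarrow> complex \<Rightarrow> real) \<Rightarrow> bool" where
  "approximate_identity I le \<phi> \<longleftrightarrow> directed_on I le \<and>
     (\<forall>l\<in>I. integrable circle (\<phi> l)) \<and>
     (\<forall>l\<in>I. AE z in circle. 0 \<le> \<phi> l z) \<and>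
     (\<forall>l\<in>I. (LINT z|circle. \<phi> l z) = 1) \<and>
     (\<forall>U. openin (top_of_set (sphere 0 1)) U \<and> 1 \<in> U \<longrightarrow>
        (\<forall>e>0. \<forall>\<^sub>F l in net_filter I le.
           AE z in circle. z \<in> sphere 0 1 - U \<longrightarrow> \<bar>\<phi> l z\<bar> < e))"

end

theory Submission
  imports Defs
begin

text \<open>
  Averaging over unimodular functions shows that \<open>\<alpha>\<close> is monotone, and continuity of \<open>\<alpha>\<close> then gives a
  Fatou property along \<open>L\<^sup>1\<close> limits. For a continuous function the convolution with a probability density
  is a limit of convex combinations of rotations, so convolution contracts the norm on continuous
  functions; with the constant kernel this yields \<open>\<parallel>f\<parallel>\<^sub>1 \<le> \<alpha>(f)\<close>. Continuous functions are dense in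
  \<open>L\<^sup>\<alpha>(\<bbbT>, X)\<close>, by truncation and Lusin approximation, hence the contraction property extends by
  Fatou, and convergence reduces to continuous functions, where it is uniform.
\<close>

section \<open>The rotation invariant measure on the circle\<close>


text \<open>The obstacle is that \<open>conv f g\<close> is an integral in \<open>X\<close> at each
  point and not an integral in the norm \<alpha>, so an estimate under the integral sign is not at
  hand for general \<open>f\<close>. Replacing \<open>f\<close> by a nearby continuous
  \<open>c\<close> does not settle it directly: that \<open>conv c g\<close> is then close to
  \<open>conv f g\<close> in \<alpha> is an instance of the very bound to be shown. The way out is
  to measure this closeness in L^1, where Tonelli's theorem suffices. Hence the domination of the
  L^1 norm by \<alpha> has to precede every statement on convolutions of unbounded functions, and
  the approximation of bounded functions has to deliver one continuous function that is close in
  both norms at once. Closeness in L^1 is enough because \<open>vnorm\<close> is tested against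
  essentially bounded functions only: if such a function is at most \<open>S\<close> in modulus, a
  set of small measure contributes at most \<open>S\<close> times the norm of its indicator.\<close>

lemma measurable_circle_iff:
  "f \<in> M \<rightarrow>\<^sub>M circle \<longleftrightarrow> f \<in> borel_measurable M \<and> f \<in> space M \<rightarrow> sphere 0 1"
proof -
  have "f \<in> M \<rightarrow>\<^sub>M circle \<longleftrightarrow> f \<in> M \<rightarrow>\<^sub>M restrict_space borel (sphere 0 1)"
    by (simp add: measurable_cong_sets[OF refl sets_circle])
  then show ?thesis by (simp add: measurable_restrict_space2_iff)
qed

lemma borel_measurable_circle_continuous:
  assumes "continuous_on (sphere 0 1) f"
  shows "f \<in> borel_measurable circle"
  using borel_measurable_continuous_on_restrict[OF assms]
  by (simp add: measurable_cong_sets[OF sets_circle refl])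

lemma borel_measurable_circle_id [measurable]: "(\<lambda>z. z) \<in> borel_measurable circle"
  by (intro borel_measurable_circle_continuous continuous_intros)

lemma measurable_cis_circle [measurable]: "cis \<in> borel \<rightarrow>\<^sub>M circle"
  by (auto simp: measurable_circle_iff
      intro!: borel_measurable_continuous_onI continuous_intros)

lemma measurable_rotate:
  assumes "w \<in> sphere 0 1"
  shows "(\<lambda>z. w * z) \<in> circle \<rightarrow>\<^sub>M circle"
  using assms by (auto simp: measurable_circle_iff norm_mult)

lemma measurable_reflect:
  assumes "z \<in> sphere 0 1"
  shows "(\<lambda>w. cnj w * z) \<in> circle \<rightarrow>\<^sub>M circle"
  using assms
  by (auto simp: measurable_circle_iff norm_mult
      intro!: borel_measurable_circle_continuous continuous_intros)

lemma measurable_quotient: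
  "(\<lambda>p. cnj (snd p) * fst p) \<in> circle \<Otimes>\<^sub>M circle \<rightarrow>\<^sub>M circle"
proof -
  have cnj: "cnj \<in> borel_measurable circle"
    by (intro borel_measurable_circle_continuous continuous_intros)
  have "(\<lambda>p. cnj (snd p)) \<in> borel_measurable (circle \<Otimes>\<^sub>M circle)"
    using measurable_compose[OF measurable_snd cnj] .
  moreover have "fst \<in> borel_measurable (circle \<Otimes>\<^sub>M circle)"
    using measurable_compose[OF measurable_fst borel_measurable_circle_id] .
  ultimately show ?thesis
    by (auto simp: measurable_circle_iff space_pair_measure norm_mult)
qed

section \<open>Invariance of arc length under rotation and conjugation\<close>

lemma nn_integral_circle:
  assumes [measurable]: "F \<in> borel_measurable circle"
  shows "(\<integral>\<^sup>+z. F z \<partial>circle) =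
    (\<integral>\<^sup>+t. F (cis t) * indicator {0..<2 * pi} t \<partial>lborel) / ennreal (2 * pi)"
proof -
  have "(\<integral>\<^sup>+z. F z \<partial>circle) = (\<integral>\<^sup>+t. F (cis t) \<partial>uniform_measure lborel {0..2 * pi})"
    unfolding circle_def
  proof (rule nn_integral_distr)
    show "cis \<in> uniform_measure lborel {0..2 * pi} \<rightarrow>\<^sub>M restrict_space borel (sphere 0 1)"
      using measurable_cis_circle
      by (simp add: measurable_cong_sets[OF _ sets_circle] cong: measurable_cong_sets)
    show "F \<in> borel_measurable (distr (uniform_measure lborel {0..2 * pi})
        (restrict_space borel (sphere 0 1)) cis)"
      using assms by (simp add: circle_def)
  qed
  also have "\<dots> = (\<integral>\<^sup>+t. F (cis t) * indicator {0..2 * pi} t \<partial>lborel) / ennreal (2 * pi)"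
    by (subst nn_integral_uniform_measure) auto
  also have "(\<integral>\<^sup>+t. F (cis t) * indicator {0..2 * pi} t \<partial>lborel) =
      (\<integral>\<^sup>+t. F (cis t) * indicator {0..<2 * pi} t \<partial>lborel)"
    using AE_lborel_singleton[of "2 * pi"]
    by (intro nn_integral_cong_AE) (auto elim!: eventually_mono simp: indicator_def)
  finally show ?thesis .
qed

text \<open>With \<open>w = cis a\<close> the rotation becomes a translation by \<open>a\<close>,
  which moves the period interval to \<open>{a..<a + 2 * pi}\<close>. The part beyond
  \<open>2 * pi\<close> is pushed back by periodicity of \<open>cis\<close>. Half-open intervals
  make the pieces fit together without overlap.\<close>

lemma nn_integral_circle_rotate:
  assumes [measurable]: "F \<in> borel_measurable circle" and w: "w \<in> sphere 0 1"
  shows "(\<integral>\<^sup>+z. F (w * z) \<partial>circle) = (\<integral>\<^sup>+z. F z \<partial>circle)"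
proof -
  have "(Re w)\<^sup>2 + (Im w)\<^sup>2 = 1" using w by (simp add: cmod_def)
  then obtain a where a: "0 \<le> a" "a < 2 * pi" "Re w = cos a" "Im w = sin a"
    using sincos_total_2pi by metis
  have wa: "w = cis a" using a by (simp add: complex_eq_iff)
  let ?G = "\<lambda>t. F (cis t)"
  have "(\<integral>\<^sup>+t. F (w * cis t) * indicator {0..<2 * pi} t \<partial>lborel) =
      (\<integral>\<^sup>+t. ?G t * indicator {a..<a + 2 * pi} t \<partial>lborel)"
    by (subst nn_integral_real_affine[where c = 1 and t = a])
       (auto simp: wa cis_mult indicator_def intro!: nn_integral_cong)
  also have "\<dots> = (\<integral>\<^sup>+t. ?G t * indicator {a..<2 * pi} t + ?G t * indicator {2 * pi..<a + 2 * pi} t \<partial>lborel)"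
    using a by (intro nn_integral_cong) (auto simp: indicator_def)
  also have "\<dots> = (\<integral>\<^sup>+t. ?G t * indicator {a..<2 * pi} t \<partial>lborel) +
      (\<integral>\<^sup>+t. ?G t * indicator {2 * pi..<a + 2 * pi} t \<partial>lborel)"
    by (intro nn_integral_add) auto
  also have "(\<integral>\<^sup>+t. ?G t * indicator {2 * pi..<a + 2 * pi} t \<partial>lborel) =
      (\<integral>\<^sup>+t. ?G t * indicator {0..<a} t \<partial>lborel)"
    by (subst nn_integral_real_affine[where c = 1 and t = "2 * pi"])
       (auto simp: cis_mult[symmetric] indicator_def intro!: nn_integral_cong)
  also have "(\<integral>\<^sup>+t. ?G t * indicator {a..<2 * pi} t \<partial>lborel) + \<dots> =
      (\<integral>\<^sup>+t. ?G t * indicator {a..<2 * pi} t + ?G t * indicator {0..<a} t \<partial>lborel)"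
    by (intro nn_integral_add[symmetric]) auto
  also have "\<dots> = (\<integral>\<^sup>+t. ?G t * indicator {0..<2 * pi} t \<partial>lborel)"
    using a by (intro nn_integral_cong) (auto simp: indicator_def)
  finally show ?thesis
    using measurable_compose[OF measurable_rotate[OF w] assms(1)]
    by (simp add: nn_integral_circle)
qed

text \<open>Conjugation is the substitution of \<open>2 * pi - t\<close> for \<open>t\<close>. It
  exchanges the open and the closed end of the period interval, hence the discarding of two single
  points.\<close>

lemma nn_integral_circle_cnj:
  assumes [measurable]: "F \<in> borel_measurable circle"
  shows "(\<integral>\<^sup>+z. F (cnj z) \<partial>circle) = (\<integral>\<^sup>+z. F z \<partial>circle)"
proof -
  have [measurable]: "(\<lambda>z. F (cnj z)) \<in> borel_measurable circle"
    using measurable_compose[OF measurable_reflect[of 1] assms] by simp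
  have per: "cnj (cis (2 * pi - t)) = cis t" for t
    by (simp add: complex_eq_iff sin_diff cos_diff)
  have "(\<integral>\<^sup>+t. F (cnj (cis t)) * indicator {0..<2 * pi} t \<partial>lborel) =
      (\<integral>\<^sup>+t. F (cis t) * indicator {0<..2 * pi} t \<partial>lborel)"
    by (subst nn_integral_real_affine[where c = "- 1" and t = "2 * pi"])
       (auto simp: per indicator_def intro!: nn_integral_cong)
  also have "\<dots> = (\<integral>\<^sup>+t. F (cis t) * indicator {0..<2 * pi} t \<partial>lborel)"
  proof (rule nn_integral_cong_AE)
    show "AE t in lborel. F (cis t) * indicator {0<..2 * pi} t =
        F (cis t) * indicator {0..<2 * pi} t"
      using AE_lborel_singleton[of "2 * pi"] AE_lborel_singleton[of "0::real"]
      by eventually_elim (auto simp: indicator_def)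
  qed
  finally show ?thesis by (simp add: nn_integral_circle)
qed

lemma nn_integral_circle_reflect:
  assumes F [measurable]: "F \<in> borel_measurable circle" and z: "z \<in> sphere 0 1"
  shows "(\<integral>\<^sup>+w. F (cnj w * z) \<partial>circle) = (\<integral>\<^sup>+w. F w \<partial>circle)"
proof -
  have "(\<lambda>w. F (z * w)) \<in> borel_measurable circle"
    using measurable_compose[OF measurable_rotate[OF z] F] .
  from nn_integral_circle_cnj[OF this] nn_integral_circle_rotate[OF F z]
  show ?thesis by (simp add: mult.commute)
qed

lemma distr_circle_rotate:
  assumes w: "w \<in> sphere 0 1"
  shows "distr circle circle (\<lambda>z. w * z) = circle"
proof (rule measure_eqI)
  fix A assume "A \<in> sets (distr circle circle (\<lambda>z. w * z))"
  then have A: "A \<in> sets circle" by simp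
  have "emeasure (distr circle circle (\<lambda>z. w * z)) A =
      (\<integral>\<^sup>+z. indicator A z \<partial>distr circle circle (\<lambda>z. w * z))"
    using A by simp
  also have "\<dots> = (\<integral>\<^sup>+z. indicator A (w * z) \<partial>circle)"
    using A by (intro nn_integral_distr measurable_rotate w) auto
  also have "\<dots> = emeasure circle A"
    using A by (subst nn_integral_circle_rotate[OF _ w]) auto
  finally show "emeasure (distr circle circle (\<lambda>z. w * z)) A = emeasure circle A" .
qed simp

text \<open>The map is conjugation followed by a rotation. It is the change of variable in the
  integral that defines \<open>conv\<close> at the point \<open>z\<close>.\<close>

lemma distr_circle_reflect:
  assumes z: "z \<in> sphere 0 1"
  shows "distr circle circle (\<lambda>w. cnj w * z) = circle"
proof (rule measure_eqI)
  fix A assume "A \<in> sets (distr circle circle (\<lambda>w. cnj w * z))"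
  then have A: "A \<in> sets circle" by simp
  have "emeasure (distr circle circle (\<lambda>w. cnj w * z)) A =
      (\<integral>\<^sup>+w. indicator A w \<partial>distr circle circle (\<lambda>w. cnj w * z))"
    using A by simp
  also have "\<dots> = (\<integral>\<^sup>+w. indicator A (cnj w * z) \<partial>circle)"
    using A by (intro nn_integral_distr measurable_reflect z) auto
  also have "\<dots> = emeasure circle A"
    using A by (subst nn_integral_circle_reflect[OF _ z]) auto
  finally show "emeasure (distr circle circle (\<lambda>w. cnj w * z)) A = emeasure circle A" .
qed simp

lemma AE_circle_rotate:
  assumes w: "w \<in> sphere 0 1" and P: "AE z in circle. P z"
  shows "AE z in circle. P (w * z)"
proof -
  have "AE z in distr circle circle (\<lambda>z. w * z). P z"
    using P by (simp only: distr_circle_rotate[OF w])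
  then show ?thesis by (rule AE_distrD[OF measurable_rotate[OF w]])
qed

section \<open>Extension of a symmetric seminorm to measurable functions\<close>


lemma LinftyI:
  assumes "f \<in> borel_measurable circle" "AE z in circle. norm (f z) \<le> C"
  shows "f \<in> Linfty"
  using assms by (auto simp: Linfty_def)

lemma LinftyE:
  assumes "f \<in> Linfty"
  obtains C where "f \<in> borel_measurable circle" "0 \<le> C" "AE z in circle. norm (f z) \<le> C"
proof -
  from assms obtain C where C: "f \<in> borel_measurable circle" "AE z in circle. norm (f z) \<le> C"
    by (auto simp: Linfty_def)
  have "AE z in circle. norm (f z) \<le> max 0 C" using C(2) by eventually_elim simp
  with C(1) show ?thesis by (intro that[of "max 0 C"]) auto
qed

lemma Linfty_measurable: "f \<in> Linfty \<Longrightarrow> f \<in> borel_measurable circle"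
  by (simp add: Linfty_def)

lemma Linfty_dominated:
  assumes "g \<in> Linfty" "f \<in> borel_measurable circle"
    and "AE z in circle. norm (f z) \<le> norm (g z)"
  shows "f \<in> Linfty"
proof -
  obtain C where "AE z in circle. norm (g z) \<le> C" using assms(1) by (rule LinftyE)
  with assms(3) have "AE z in circle. norm (f z) \<le> C" by eventually_elim simp
  with assms(2) show ?thesis by (rule LinftyI)
qed

lemma simple_function_Linfty:
  assumes "simple_function circle s"
  shows "s \<in> Linfty"
proof (rule LinftyI)
  show "s \<in> borel_measurable circle" using assms by (rule borel_measurable_simple_function)
  have "finite (norm ` s ` space circle)" using simple_functionD(1)[OF assms] by simp
  then have "\<And>z. z \<in> space circle \<Longrightarrow> norm (s z) \<le> Max (norm ` s ` space circle)"
    by (intro Max_ge) auto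
  then show "AE z in circle. norm (s z) \<le> Max (norm ` s ` space circle)"
    by (intro AE_I2) auto
qed

lemma ext_norm_cong: "(\<And>z. norm (f z) = norm (g z)) \<Longrightarrow> ext \<alpha> f = ext \<alpha> g"
  by (simp add: ext_def)

text \<open>\<open>ext\<close> sees its argument only through the modulus, so scalar functions can
  be handled by \<open>vnorm\<close> and a single calculus serves all value types.\<close>

lemma ext_eq_vnorm: "ext \<alpha> f = vnorm \<alpha> f"
  unfolding vnorm_def by (rule ext_norm_cong) simp

locale symmetric_seminorm =
  fixes \<alpha> :: "(complex \<Rightarrow> complex) \<Rightarrow> real"
  assumes Rc: "\<alpha> \<in> Rc"
begin

lemma
  shows nonneg: "f \<in> Linfty \<Longrightarrow> 0 \<le> \<alpha> f"
    and cong_AE: "f \<in> Linfty \<Longrightarrow> g \<in> Linfty \<Longrightarrow> (AE z in circle. f z = g z) \<Longrightarrow> \<alpha> f = \<alpha> g"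
    and add_le: "f \<in> Linfty \<Longrightarrow> g \<in> Linfty \<Longrightarrow> \<alpha> (\<lambda>z. f z + g z) \<le> \<alpha> f + \<alpha> g"
    and scale: "f \<in> Linfty \<Longrightarrow> \<alpha> (\<lambda>z. c * f z) = norm c * \<alpha> f"
    and one: "\<alpha> (\<lambda>_. 1) = 1"
    and norm_eq: "f \<in> Linfty \<Longrightarrow> \<alpha> (\<lambda>z. complex_of_real (norm (f z))) = \<alpha> f"
    and rotate_eq: "f \<in> Linfty \<Longrightarrow> w \<in> sphere 0 1 \<Longrightarrow> \<alpha> (\<lambda>z. f (cnj w * z)) = \<alpha> f"
    and small_indicator: "e > 0 \<Longrightarrow> \<exists>d>0. \<forall>E\<in>sets circle.
        0 < measure circle E \<and> measure circle E < d \<longrightarrow> \<alpha> (indicator E) < e"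
  using Rc unfolding Rc_def by blast+

text \<open>Modulo null sets \<open>\<bar>f\<bar>\<close> is \<open>h \<bar>g\<bar>\<close> with \<open>0 \<le> h \<le> 1\<close>, and \<open>h\<close> is the average of the two
  unimodular functions \<open>h \<plusminus> \<i> \<surd>(1 - h\<^sup>2)\<close>.\<close>

lemma mono:
  assumes f: "f \<in> Linfty" and g: "g \<in> Linfty"
    and le: "AE z in circle. norm (f z) \<le> norm (g z)"
  shows "\<alpha> f \<le> \<alpha> g"
proof -
  note [measurable] = Linfty_measurable[OF f] Linfty_measurable[OF g]
  \<comment> \<open>The cap at 1 keeps \<open>h\<close> in the unit interval at every point, also on
    the null set where the domination fails. Where \<open>g z = 0\<close>, division by zero gives
    \<open>h z = 0\<close>, which is the right value since \<open>f z = 0\<close> there up to a null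
    set.\<close>
  define h where "h z = min 1 (norm (f z) / norm (g z))" for z
  have h: "0 \<le> h z" "h z \<le> 1" for z by (auto simp: h_def)
  define u where "u z = complex_of_real (h z) + \<i> * complex_of_real (sqrt (1 - (h z)\<^sup>2))" for z
  have h2: "(h z)\<^sup>2 \<le> 1" for z using h[of z] by (simp add: power_le_one)
  have u: "norm (u z) = 1" for z using h2[of z] by (simp add: u_def cmod_def)
  have [measurable]: "h \<in> borel_measurable circle" by (simp add: h_def[abs_def])
  have um [measurable]: "u \<in> borel_measurable circle" by (simp add: u_def[abs_def])
  define v where "v z = complex_of_real (h z) - \<i> * complex_of_real (sqrt (1 - (h z)\<^sup>2))" for z
  have v: "norm (v z) = 1" for z using h2[of z] by (simp add: v_def cmod_def)
  have vm [measurable]: "v \<in> borel_measurable circle" by (simp add: v_def[abs_def])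
  let ?U = "\<lambda>z. u z * complex_of_real (norm (g z))"
  let ?V = "\<lambda>z. v z * complex_of_real (norm (g z))"
  have L: "?U \<in> Linfty" "?V \<in> Linfty"
    by (rule Linfty_dominated[OF g]; simp add: norm_mult u v)+
  have \<alpha>U: "\<alpha> ?U = \<alpha> g" "\<alpha> ?V = \<alpha> g"
    using norm_eq[OF L(1)] norm_eq[OF L(2)] norm_eq[OF g] by (simp_all add: norm_mult u v)
  have LU: "(\<lambda>z. ?U z + ?V z) \<in> Linfty"
  proof (rule Linfty_dominated)
    show "(\<lambda>z. 2 * g z) \<in> Linfty"
    proof -
      obtain C where "AE z in circle. norm (g z) \<le> C" using g by (rule LinftyE)
      then have "AE z in circle. norm (2 * g z) \<le> 2 * C" by eventually_elim (simp add: norm_mult)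
      then show ?thesis by (intro LinftyI[where C = "2 * C"]) auto
    qed
    show "AE z in circle. norm (?U z + ?V z) \<le> norm (2 * g z)"
      by (rule AE_I2, rule order_trans[OF norm_triangle_ineq]) (simp add: norm_mult u v)
  qed measurable
  have "\<alpha> f = \<alpha> (\<lambda>z. complex_of_real (norm (f z)))" using f by (simp add: norm_eq)
  also have "\<dots> = \<alpha> (\<lambda>z. (1 / 2) * (?U z + ?V z))"
  proof (rule cong_AE)
    show "(\<lambda>z. complex_of_real (norm (f z))) \<in> Linfty"
      by (rule Linfty_dominated[OF f]) auto
    show "(\<lambda>z. (1 / 2) * (?U z + ?V z)) \<in> Linfty"
      by (rule Linfty_dominated[OF LU]) (auto simp: norm_mult)
    show "AE z in circle. complex_of_real (norm (f z)) = (1 / 2) * (?U z + ?V z)"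
      using le
    proof eventually_elim
      fix z assume z: "norm (f z) \<le> norm (g z)"
      have "norm (f z) = h z * norm (g z)"
        using z by (cases "g z = 0") (auto simp: h_def min_def field_simps)
      moreover have "(1 / 2) * (?U z + ?V z) = complex_of_real (h z * norm (g z))"
        by (simp add: u_def v_def algebra_simps)
      ultimately show "complex_of_real (norm (f z)) = (1 / 2) * (?U z + ?V z)" by simp
    qed
  qed
  also have "\<dots> = 1 / 2 * \<alpha> (\<lambda>z. ?U z + ?V z)" using scale[OF LU, of "1/2"] by simp
  also have "\<dots> \<le> \<alpha> g" using add_le[OF L] \<alpha>U by simp
  finally show ?thesis .
qed

section \<open>Comparison with constants and the calculus of \<open>vnorm\<close>\<close>

lemma bound:
  assumes "f \<in> borel_measurable circle" "0 \<le> C" "AE z in circle. norm (f z) \<le> C"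
  shows "\<alpha> f \<le> C"
proof -
  have "\<alpha> f \<le> \<alpha> (\<lambda>z. complex_of_real C * 1)"
    using assms by (intro mono LinftyI[of _ C]) auto
  also have "\<dots> = C" using scale[OF LinftyI[of "\<lambda>_. 1" 1], of "complex_of_real C"] assms(2)
    by (simp add: one)
  finally show ?thesis .
qed

text \<open>The supremum in \<open>ext\<close> runs over simple functions only. Rounding the modulus
  of \<open>b\<close> down to a multiple of \<open>e\<close> gives a simple function within
  \<open>e\<close> of it uniformly, at a cost of at most \<open>e\<close> in \<alpha>. Together with
  \<open>vnorm_least\<close> this makes \<open>vnorm\<close> the supremum of \<alpha> over all
  dominated functions in \<open>Linfty\<close>, and simple functions are not met again.\<close>

lemma vnorm_upper:
  assumes b: "b \<in> Linfty" and le: "AE z in circle. norm (b z) \<le> norm (f z)"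
  shows "ennreal (\<alpha> b) \<le> vnorm \<alpha> f"
proof (rule ennreal_le_epsilon)
  fix e :: real assume e: "0 < e"
  obtain C where C [measurable]: "b \<in> borel_measurable circle" "0 \<le> C"
    and bC: "AE z in circle. norm (b z) \<le> C" using b by (rule LinftyE)
  \<comment> \<open>The bound on \<open>b\<close> holds almost everywhere only; the cap makes it
    hold everywhere, so that the rounded function has finite range.\<close>
  define h where "h z = min C (norm (b z))" for z
  define s where "s z = e * of_int \<lfloor>h z / e\<rfloor>" for z
  have h: "0 \<le> h z" "h z \<le> C" "h z \<le> norm (b z)" for z using C by (auto simp: h_def)
  have [measurable]: "h \<in> borel_measurable circle" by (simp add: h_def[abs_def])
  have sh: "s z \<le> h z" "h z - s z \<le> e" "0 \<le> s z" for z
  proof -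
    have "of_int \<lfloor>h z / e\<rfloor> \<le> h z / e" "h z / e \<le> of_int \<lfloor>h z / e\<rfloor> + 1" by linarith+
    from this[THEN mult_left_mono, of e] e show "s z \<le> h z" "h z - s z \<le> e"
      by (simp_all add: s_def algebra_simps)
    show "0 \<le> s z" using e h[of z] by (simp add: s_def)
  qed
  have [measurable]: "s \<in> borel_measurable circle" by (simp add: s_def[abs_def])
  have "simple_function circle (\<lambda>z. complex_of_real (s z))"
  proof (rule simple_function_borel_measurable)
    have "\<lfloor>h z / e\<rfloor> \<in> {0..\<lfloor>C / e\<rfloor>}" for z
      using e h[of z] by (auto intro!: floor_mono divide_right_mono)
    then have "(\<lambda>z. complex_of_real (s z)) ` space circle \<subseteq>
        (\<lambda>k. complex_of_real (e * of_int k)) ` {0..\<lfloor>C / e\<rfloor>}"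
      unfolding s_def by blast
    then show "finite ((\<lambda>z. complex_of_real (s z)) ` space circle)"
      by (rule finite_subset) simp
  qed measurable
  moreover have "AE z in circle. norm (complex_of_real (s z)) \<le> norm (complex_of_real (norm (f z)))"
    using le
  proof eventually_elim
    fix z assume "norm (b z) \<le> norm (f z)"
    then show "norm (complex_of_real (s z)) \<le> norm (complex_of_real (norm (f z)))"
      using sh[of z] h[of z] by simp
  qed
  ultimately have sf: "ennreal (\<alpha> (\<lambda>z. complex_of_real (s z))) \<le> vnorm \<alpha> f"
    unfolding vnorm_def ext_def by (intro SUP_upper) auto
  have L: "(\<lambda>z. complex_of_real (s z)) \<in> Linfty" "(\<lambda>z. complex_of_real (h z - s z)) \<in> Linfty"
    "(\<lambda>z. complex_of_real (h z)) \<in> Linfty"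
    using sh h order_trans[OF sh(1) h(2)]
    by (auto intro!: LinftyI[where C = C] simp: norm_of_real abs_of_nonneg simp del: of_real_diff)
      (smt (verit) AE_I2)
  have "\<alpha> b \<le> \<alpha> (\<lambda>z. complex_of_real (h z))"
    using bC h by (intro mono b L) (auto elim!: eventually_mono simp: h_def)
  also have "\<dots> \<le> \<alpha> (\<lambda>z. complex_of_real (s z)) + \<alpha> (\<lambda>z. complex_of_real (h z - s z))"
    using add_le[OF L(1,2)] by simp
  also have "\<alpha> (\<lambda>z. complex_of_real (h z - s z)) \<le> e"
    using sh e by (intro bound) (auto simp: norm_of_real abs_of_nonneg simp del: of_real_diff)
  finally have "ennreal (\<alpha> b) \<le> ennreal (\<alpha> (\<lambda>z. complex_of_real (s z)) + e)"
    by (simp add: ennreal_leI)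
  also have "\<dots> = ennreal (\<alpha> (\<lambda>z. complex_of_real (s z))) + ennreal e"
    using e nonneg[OF L(1)] by (simp add: ennreal_plus)
  also have "\<dots> \<le> vnorm \<alpha> f + ennreal e" using sf by (rule add_right_mono)
  finally show "ennreal (\<alpha> b) \<le> vnorm \<alpha> f + ennreal e" .
qed

lemma vnorm_least:
  assumes "\<And>b. b \<in> Linfty \<Longrightarrow> AE z in circle. norm (b z) \<le> norm (f z) \<Longrightarrow> ennreal (\<alpha> b) \<le> C"
  shows "vnorm \<alpha> f \<le> C"
  unfolding vnorm_def ext_def
  by (rule SUP_least) (auto intro!: assms simple_function_Linfty)

lemma vnorm_mono:
  assumes "AE z in circle. norm (f z) \<le> norm (g z)"
  shows "vnorm \<alpha> f \<le> vnorm \<alpha> g"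
proof (rule vnorm_least)
  fix b assume b: "b \<in> Linfty" and bf: "AE z in circle. norm (b z) \<le> norm (f z)"
  from assms bf have "AE z in circle. norm (b z) \<le> norm (g z)" by eventually_elim simp
  then show "ennreal (\<alpha> b) \<le> vnorm \<alpha> g" by (rule vnorm_upper[OF b])
qed

text \<open>A test function \<open>b\<close> is cut at the height of \<open>f\<close>: the lower
  part is dominated by \<open>f\<close>, and what remains is dominated by \<open>g\<close>. Asking
  only for a pointwise estimate of norms allows three different value types.\<close>

lemma vnorm_triangle:
  assumes [measurable]: "f \<in> borel_measurable circle"
    and le: "AE z in circle. norm (h z) \<le> norm (f z) + norm (g z)"
  shows "vnorm \<alpha> h \<le> vnorm \<alpha> f + vnorm \<alpha> g"
proof (rule vnorm_least)
  fix b assume b: "b \<in> Linfty" and bh: "AE z in circle. norm (b z) \<le> norm (h z)"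
  note [measurable] = Linfty_measurable[OF b]
  let ?p = "\<lambda>z. complex_of_real (min (norm (b z)) (norm (f z)))"
  let ?q = "\<lambda>z. complex_of_real (norm (b z) - min (norm (b z)) (norm (f z)))"
  have L: "?p \<in> Linfty" "?q \<in> Linfty"
    by (rule Linfty_dominated[OF b]; simp add: min_def norm_of_real del: of_real_diff)+
  have p: "ennreal (\<alpha> ?p) \<le> vnorm \<alpha> f" by (rule vnorm_upper[OF L(1)]) auto
  have "AE z in circle. norm (?q z) \<le> norm (g z)"
    using le bh by eventually_elim (simp add: min_def norm_of_real del: of_real_diff)
  then have q: "ennreal (\<alpha> ?q) \<le> vnorm \<alpha> g" by (rule vnorm_upper[OF L(2)])
  have "\<alpha> b \<le> \<alpha> ?p + \<alpha> ?q" using add_le[OF L] norm_eq[OF b] by simp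
  then have "ennreal (\<alpha> b) \<le> ennreal (\<alpha> ?p) + ennreal (\<alpha> ?q)"
    using nonneg L by (simp add: ennreal_leI flip: ennreal_plus)
  also have "\<dots> \<le> vnorm \<alpha> f + vnorm \<alpha> g" using p q by (rule add_mono)
  finally show "ennreal (\<alpha> b) \<le> vnorm \<alpha> f + vnorm \<alpha> g" .
qed

lemma vnorm_bound:
  assumes "0 \<le> C" "AE z in circle. norm (f z) \<le> C"
  shows "vnorm \<alpha> f \<le> ennreal C"
proof (rule vnorm_least)
  fix b assume b: "b \<in> Linfty" and "AE z in circle. norm (b z) \<le> norm (f z)"
  with assms have "AE z in circle. norm (b z) \<le> C" by (auto elim: eventually_elim2)
  with b assms(1) show "ennreal (\<alpha> b) \<le> ennreal C"
    by (intro ennreal_leI bound Linfty_measurable)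
qed

lemma vnorm_const: "ennreal (norm x) \<le> vnorm \<alpha> (\<lambda>_. x)"
proof -
  have "(\<lambda>_. 1) \<in> Linfty" by (rule LinftyI[of _ 1]) auto
  then have "norm x = \<alpha> (\<lambda>_. complex_of_real (norm x) * 1)"
    using scale[of "\<lambda>_. 1" "complex_of_real (norm x)"] by (simp add: one)
  also have "ennreal \<dots> \<le> vnorm \<alpha> (\<lambda>_. x)"
    by (rule vnorm_upper) (auto intro: LinftyI[of _ "norm x"])
  finally show ?thesis .
qed

text \<open>A test function for \<open>g\<close>, divided by \<open>c\<close>, is a test function
  for \<open>f\<close>.\<close>

lemma vnorm_scale:
  assumes le: "AE z in circle. norm (g z) \<le> c * norm (f z)" and c: "0 \<le> c"
  shows "vnorm \<alpha> g \<le> ennreal c * vnorm \<alpha> f"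
proof (rule vnorm_least)
  fix b assume b: "b \<in> Linfty" and bf: "AE z in circle. norm (b z) \<le> norm (g z)"
  show "ennreal (\<alpha> b) \<le> ennreal c * vnorm \<alpha> f"
  \<comment> \<open>In \<open>ennreal\<close> the product of 0 and infinity is 0, so for
    \<open>c = 0\<close> the bound is 0 even if \<open>f\<close> has infinite norm.\<close>
  proof (cases "c = 0")
    case True
    have "AE z in circle. norm (b z) \<le> 0" using bf le by eventually_elim (simp add: True)
    then have "\<alpha> b \<le> 0" using b by (intro bound Linfty_measurable) auto
    then show ?thesis by (simp add: ennreal_neg)
  next
    case False
    with c have c: "c > 0" by simp
    let ?b = "\<lambda>z. complex_of_real (1 / c) * b z"
    have bL: "?b \<in> Linfty"
    proof -
      obtain C where "AE z in circle. norm (b z) \<le> C" using b by (rule LinftyE)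
      then have "AE z in circle. norm (?b z) \<le> C / c"
        using c by (auto elim!: eventually_mono simp: norm_divide divide_right_mono)
      then show ?thesis using Linfty_measurable[OF b] by (intro LinftyI) auto
    qed
    have "\<alpha> b = c * \<alpha> ?b" using c scale[OF b, of "complex_of_real (1 / c)"]
      by (simp add: norm_divide)
    then have "ennreal (\<alpha> b) = ennreal c * ennreal (\<alpha> ?b)"
      using c nonneg[OF bL] by (simp add: ennreal_mult)
    also have "ennreal (\<alpha> ?b) \<le> vnorm \<alpha> f"
    proof (rule vnorm_upper[OF bL])
      show "AE z in circle. norm (?b z) \<le> norm (f z)"
        using bf le by eventually_elim (use c in \<open>simp add: norm_divide field_simps\<close>)
    qed
    finally show ?thesis by (simp add: mult_left_mono)
  qed
qed

text \<open>The symmetry of \<alpha> is given on \<open>Linfty\<close>; it passes to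
  \<open>vnorm\<close> because rotating back turns a test function for the rotated function into one
  for \<open>f\<close>.\<close>

lemma vnorm_rotate:
  assumes w: "w \<in> sphere 0 1"
  shows "vnorm \<alpha> (\<lambda>z. f (cnj w * z)) \<le> vnorm \<alpha> f"
proof (rule vnorm_least)
  fix b assume b: "b \<in> Linfty" and bf: "AE z in circle. norm (b z) \<le> norm (f (cnj w * z))"
  obtain C where C: "AE z in circle. norm (b z) \<le> C" using b by (rule LinftyE)
  have ww: "cnj w * (w * z) = z" for z
    using w by (simp add: mult.assoc[symmetric] mult.commute[of "cnj w"] complex_norm_square[symmetric])
  have "(\<lambda>z. b (w * z)) \<in> Linfty"
    using measurable_compose[OF measurable_rotate[OF w] Linfty_measurable[OF b]]
      AE_circle_rotate[OF w C] by (rule LinftyI)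
  moreover have "AE z in circle. norm (b (w * z)) \<le> norm (f z)"
    using AE_circle_rotate[OF w bf] by (simp only: ww)
  ultimately have "ennreal (\<alpha> (\<lambda>z. b (w * z))) \<le> vnorm \<alpha> f" by (rule vnorm_upper)
  then show "ennreal (\<alpha> b) \<le> vnorm \<alpha> f"
    using rotate_eq[OF b, of "cnj w"] w by simp
qed

text \<open>The continuity condition in \<open>Rc\<close> speaks of sets of positive measure. Null
  sets are added here, so that exceptional sets need no case distinction later.\<close>

lemma vnorm_small_indicator:
  assumes e: "e > 0"
  obtains d where "d > 0" and
    "\<And>E. E \<in> sets circle \<Longrightarrow> measure circle E < d \<Longrightarrow>
      vnorm \<alpha> (indicator E :: complex \<Rightarrow> real) \<le> ennreal e"
proof -
  interpret prob_space circle by (rule prob_space_circle)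
  obtain d where d: "d > 0" "\<And>E. E \<in> sets circle \<Longrightarrow> 0 < measure circle E \<Longrightarrow>
      measure circle E < d \<Longrightarrow> \<alpha> (indicator E) < e"
    using small_indicator[OF e] by blast
  show thesis
  proof (rule that[OF d(1)])
    fix E assume E: "E \<in> sets circle" "measure circle E < d"
    show "vnorm \<alpha> (indicator E :: complex \<Rightarrow> real) \<le> ennreal e"
    proof (cases "measure circle E = 0")
      case True
      then have "E \<in> null_sets circle" using E by (auto simp: emeasure_eq_measure)
      then have "AE z in circle. z \<notin> E" by (rule AE_not_in)
      then have "AE z in circle. norm (indicator E z :: real) \<le> e"
        by eventually_elim (use e in \<open>simp add: indicator_def\<close>)
      then show ?thesis using e by (intro vnorm_bound) auto
    next
      case False
      then have lt: "\<alpha> (indicator E) < e" using d(2)[OF E(1)] E(2) by (simp add: zero_less_measure_iff)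
      have L: "(indicator E :: complex \<Rightarrow> complex) \<in> Linfty"
        using E(1) by (intro LinftyI[of _ 1]) (auto simp: indicator_def)
      show ?thesis
      proof (rule vnorm_least)
        fix b assume b: "b \<in> Linfty" and "AE z in circle. norm (b z) \<le> norm (indicator E z :: real)"
        then have "AE z in circle. norm (b z) \<le> norm (indicator E z :: complex)"
          by (auto elim!: eventually_mono simp: indicator_def)
        from mono[OF b L this] lt show "ennreal (\<alpha> b) \<le> ennreal e" by (intro ennreal_leI) simp
      qed
    qed
  qed
qed

end

section \<open>Approximation by continuous functions\<close>


interpretation circle: prob_space circle
  by (rule prob_space_circle)

interpretation circle_pair: pair_sigma_finite circle circle ..

text \<open>Markov's inequality, in the form that turns closeness in L^1 into uniform closeness off
  a set of small measure.\<close>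

lemma circle_measure_norm_ge:
  fixes h :: "complex \<Rightarrow> 'b::{real_normed_vector, second_countable_topology}"
  assumes [measurable]: "h \<in> borel_measurable circle"
    and le: "(\<integral>\<^sup>+z. norm (h z) \<partial>circle) \<le> ennreal e" and e: "0 \<le> e" and a: "a > 0"
  shows "measure circle {z \<in> space circle. a \<le> norm (h z)} \<le> e / a"
proof -
  have "emeasure circle {z \<in> space circle. a \<le> norm (h z)} \<le>
      emeasure circle {z \<in> space circle. 1 \<le> ennreal (1 / a) * ennreal (norm (h z))}"
    using a by (intro emeasure_mono) (auto simp: field_simps simp flip: ennreal_mult simp del: space_circle)
  also have "\<dots> \<le> ennreal (1 / a) * (\<integral>\<^sup>+z\<in>space circle. norm (h z) \<partial>circle)"
    by (rule nn_integral_Markov_inequality) (simp_all del: space_circle)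
  also have "(\<integral>\<^sup>+z\<in>space circle. norm (h z) \<partial>circle) = (\<integral>\<^sup>+z. norm (h z) \<partial>circle)"
    by (intro nn_integral_cong) auto
  also have "ennreal (1 / a) * (\<integral>\<^sup>+z. norm (h z) \<partial>circle) \<le> ennreal (1 / a) * ennreal e"
    using le by (rule mult_left_mono) simp
  also have "\<dots> = ennreal (e / a)" using a e by (simp flip: ennreal_mult)
  finally show ?thesis using a e by (simp add: circle.emeasure_eq_measure)
qed

text \<open>Regularity encloses \<open>A\<close> between a closed \<open>K\<close> and an open
  \<open>U\<close>. A Urysohn function for this pair can differ from the indicator only on
  \<open>U - K\<close>, whose measure is less than \<open>e\<close>.\<close>

lemma indicator_approx_continuous:
  assumes A: "A \<in> sets circle" and e: "e > 0"
  obtains u :: "complex \<Rightarrow> real" where "continuous_on UNIV u"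
    "(\<integral>\<^sup>+z. \<bar>indicat_real A z - u z\<bar> \<partial>circle) \<le> ennreal e"
proof -
  \<comment> \<open>Arc length is carried to a Borel measure on the whole plane, where regularity
    and Urysohn's lemma are available.\<close>
  define M where "M = distr circle borel (\<lambda>z. z)"
  have M: "sets M = sets borel" "space M = UNIV" by (simp_all add: M_def)
  interpret M: prob_space M unfolding M_def by (rule circle.prob_space_distr) measurable
  have emM: "emeasure M B = emeasure circle (B \<inter> sphere 0 1)" if "B \<in> sets borel" for B
    using that by (simp add: M_def emeasure_distr vimage_def Int_def)
  have AB: "A \<in> sets borel"
    using A by (auto simp: sets_circle sets_restrict_space)
  have outer: "\<exists>U. B \<subseteq> U \<and> open U \<and> measure M U < measure M B + e / 2" if B: "B \<in> sets borel" for B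
  proof -
    have "emeasure M B < emeasure M B + ennreal (e / 2)"
      using e by (simp add: M.emeasure_eq_measure ennreal_less_iff flip: ennreal_plus)
    then have "(INF U \<in> {U. B \<subseteq> U \<and> open U}. emeasure M U) < emeasure M B + ennreal (e / 2)"
      using outer_regular[OF M(1) _ B] by simp
    then show ?thesis
      using e by (auto simp: INF_less_iff M.emeasure_eq_measure ennreal_less_iff simp flip: ennreal_plus)
  qed
  obtain U where U: "A \<subseteq> U" "open U" "measure M U < measure M A + e / 2"
    using outer[OF AB] by blast
  obtain V where V: "- A \<subseteq> V" "open V" "measure M V < measure M (- A) + e / 2"
    using outer[of "- A"] AB by (auto simp: Compl_eq_Diff_UNIV)
  \<comment> \<open>Outer regularity of the complement of \<open>A\<close> is inner regularity of
    \<open>A\<close> by closed sets.\<close>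
  define K where "K = - V"
  have "measure M (- A) = 1 - measure M A" "measure M V = 1 - measure M K"
    using AB V M.prob_compl[of A] M.prob_compl[of K]
    by (auto simp: M K_def Compl_eq_Diff_UNIV double_diff)
  then have K: "K \<subseteq> A" "closed K" "measure M A < measure M K + e / 2"
    using V by (auto simp: K_def)
  have KU [measurable]: "K \<in> sets borel" "U \<in> sets borel"
    using K U by auto
  have cl: "closed K" "closed (- U)" "K \<inter> - U = {}" using K U by auto
  obtain u :: "complex \<Rightarrow> real" where u: "continuous_on UNIV u" "\<And>z. u z \<in> closed_segment 1 0"
    "\<And>z. z \<in> K \<Longrightarrow> u z = 1" "\<And>z. z \<in> - U \<Longrightarrow> u z = 0"
    by (rule Urysohn[OF cl, of 1 0]) blast
  have u01: "0 \<le> u z" "u z \<le> 1" for z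
    using u(2)[of z] by (auto simp: closed_segment_eq_real_ivl)
  have le: "\<bar>indicat_real A z - u z\<bar> \<le> (indicator (U - K) z :: real)" for z
    using u(3,4)[of z] u01[of z] K U by (auto simp: indicator_def)
  have "(\<integral>\<^sup>+z. \<bar>indicat_real A z - u z\<bar> \<partial>circle) \<le> (\<integral>\<^sup>+z. indicator (U - K) z \<partial>circle)"
  proof (rule nn_integral_mono)
    fix z show "ennreal \<bar>indicat_real A z - u z\<bar> \<le> indicator (U - K) z"
      using ennreal_leI[OF le[of z]] by (simp add: ennreal_indicator)
  qed
  also have "\<dots> = (\<integral>\<^sup>+z. indicator (U - K) z \<partial>M)"
    unfolding M_def
    by (rule nn_integral_distr[of "\<lambda>z. z" circle borel, symmetric]) (use KU in \<open>auto intro: borel_measurable_indicator\<close>)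
  also have "\<dots> = emeasure M (U - K)" using KU by (simp add: M)
  also have "\<dots> = ennreal (measure M U - measure M K)"
    using K U KU by (subst M.emeasure_eq_measure, subst M.finite_measure_Diff) (auto simp: M)
  also have "\<dots> \<le> ennreal e"
    using K(3) U(3) e
    by (intro ennreal_leI) auto
  finally show thesis using u(1) by (rule that[rotated])
qed

text \<open>Induction over Bochner integrable functions: multiples of indicators, sums, and limits
  of approximants dominated by \<open>2 * norm (f z)\<close>. This covers Banach space values
  without a separate scalar case.\<close>

lemma integrable_approx_continuous:
  fixes f :: "complex \<Rightarrow> 'b::{banach, second_countable_topology}"
  assumes "integrable circle f"
  shows "e > 0 \<Longrightarrow> \<exists>c. continuous_on (sphere 0 1) c \<and>
    (\<integral>\<^sup>+z. norm (f z - c z) \<partial>circle) \<le> ennreal e"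
  using assms
proof (induction f arbitrary: e)
  case (base A x)
  \<comment> \<open>The summand 1 keeps the denominator positive for \<open>x = 0\<close>.\<close>
  have "e / (norm x + 1) > 0" using base by (simp add: add_nonneg_pos)
  then obtain u where u: "continuous_on UNIV u"
    "(\<integral>\<^sup>+z. \<bar>indicat_real A z - u z\<bar> \<partial>circle) \<le> ennreal (e / (norm x + 1))"
    by (rule indicator_approx_continuous[OF base(1)]) blast
  have [measurable]: "u \<in> borel_measurable circle"
    using u(1) continuous_on_subset by (intro borel_measurable_circle_continuous) blast
  have [measurable]: "A \<in> sets circle" by fact
  have "(\<integral>\<^sup>+z. norm (indicator A z *\<^sub>R x - u z *\<^sub>R x) \<partial>circle) =
      (\<integral>\<^sup>+z. ennreal (norm x) * ennreal \<bar>indicat_real A z - u z\<bar> \<partial>circle)"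
    by (intro nn_integral_cong)
       (simp flip: ennreal_mult add: scaleR_diff_left[symmetric] mult.commute)
  also have "\<dots> = ennreal (norm x) * (\<integral>\<^sup>+z. \<bar>indicat_real A z - u z\<bar> \<partial>circle)"
    by (rule nn_integral_cmult) measurable
  also have "\<dots> \<le> ennreal (norm x) * ennreal (e / (norm x + 1))"
    using u(2) by (rule mult_left_mono) simp
  also have "\<dots> \<le> ennreal e"
  proof -
    have "norm x * (e / (norm x + 1)) = e * (norm x / (norm x + 1))" by simp
    also have "\<dots> \<le> e * 1" using base by (intro mult_left_mono) (auto simp: divide_le_eq_1 add_nonneg_pos)
    finally show ?thesis using base by (simp flip: ennreal_mult add: ennreal_leI)
  qed
  finally show ?case
    using u(1) by (intro exI[of _ "\<lambda>z. u z *\<^sub>R x"])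
      (auto intro!: continuous_intros intro: continuous_on_subset)
next
  case (add f g)
  from add.IH[of "e / 2"] add.prems
  obtain c d where c: "continuous_on (sphere 0 1) c"
      "(\<integral>\<^sup>+z. norm (f z - c z) \<partial>circle) \<le> ennreal (e / 2)"
    and d: "continuous_on (sphere 0 1) d"
      "(\<integral>\<^sup>+z. norm (g z - d z) \<partial>circle) \<le> ennreal (e / 2)"
    by auto
  note [measurable] = borel_measurable_integrable[OF add.hyps(1)] borel_measurable_integrable[OF add.hyps(2)]
    borel_measurable_circle_continuous[OF c(1)] borel_measurable_circle_continuous[OF d(1)]
  have "(\<integral>\<^sup>+z. norm (f z + g z - (c z + d z)) \<partial>circle) \<le>
      (\<integral>\<^sup>+z. ennreal (norm (f z - c z)) + ennreal (norm (g z - d z)) \<partial>circle)"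
    by (intro nn_integral_mono)
       (simp flip: ennreal_plus add: add_diff_add norm_triangle_ineq ennreal_leI)
  also have "\<dots> = (\<integral>\<^sup>+z. norm (f z - c z) \<partial>circle) + (\<integral>\<^sup>+z. norm (g z - d z) \<partial>circle)"
    by (rule nn_integral_add) measurable
  also have "\<dots> \<le> ennreal (e / 2) + ennreal (e / 2)" using c(2) d(2) by (rule add_mono)
  also have "\<dots> = ennreal e" using add.prems by (simp flip: ennreal_plus)
  finally show ?case
    using c(1) d(1) by (intro exI[of _ "\<lambda>z. c z + d z"]) (auto intro!: continuous_intros)
next
  case (lim f s)
  note [measurable] = borel_measurable_integrable[OF lim.hyps(4)] borel_measurable_integrable[OF lim.hyps(1)]
  have "(\<lambda>i. \<integral>\<^sup>+z. norm (f z - s i z) \<partial>circle) \<longlonglongrightarrow> 0"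
  proof (rule nn_integral_dominated_convergence_norm)
    show "AE z in circle. norm (s i z) \<le> 2 * norm (f z)" for i using lim.hyps(3) by auto
    show "(\<integral>\<^sup>+z. ennreal (2 * norm (f z)) \<partial>circle) < \<infinity>"
      using lim.hyps(4) integrable_iff_bounded[of circle "\<lambda>z. 2 * norm (f z)"] by simp
    show "AE z in circle. (\<lambda>i. s i z) \<longlonglongrightarrow> f z" using lim.hyps(2) by auto
  qed measurable
  then have "\<forall>\<^sub>F i in sequentially. (\<integral>\<^sup>+z. norm (f z - s i z) \<partial>circle) < ennreal (e / 2)"
    using lim.prems by (intro order_tendstoD) auto
  then obtain i where i: "(\<integral>\<^sup>+z. norm (f z - s i z) \<partial>circle) < ennreal (e / 2)"
    by (auto simp: eventually_sequentially)
  from lim.IH[of "e / 2" i] lim.prems obtain c where c: "continuous_on (sphere 0 1) c"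
    "(\<integral>\<^sup>+z. norm (s i z - c z) \<partial>circle) \<le> ennreal (e / 2)" by auto
  note [measurable] = borel_measurable_circle_continuous[OF c(1)]
  have "(\<integral>\<^sup>+z. norm (f z - c z) \<partial>circle) \<le>
      (\<integral>\<^sup>+z. ennreal (norm (f z - s i z)) + ennreal (norm (s i z - c z)) \<partial>circle)"
    by (intro nn_integral_mono)
       (simp flip: ennreal_plus add: norm_diff_triangle_le[OF order_refl order_refl] ennreal_leI)
  also have "\<dots> = (\<integral>\<^sup>+z. norm (f z - s i z) \<partial>circle) + (\<integral>\<^sup>+z. norm (s i z - c z) \<partial>circle)"
    by (rule nn_integral_add) measurable
  also have "\<dots> \<le> ennreal (e / 2) + ennreal (e / 2)" using i c(2) by (intro add_mono) auto
  also have "\<dots> = ennreal e" using lim.prems by (simp flip: ennreal_plus)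
  finally show ?case using c(1) by auto
qed

text \<open>An L^1 approximant is retracted radially onto the ball of radius \<open>C\<close>. It
  moves by its excess over \<open>C\<close>, which is at most its distance from \<open>f z\<close>
  because \<open>f z\<close> lies in the ball. The error therefore at most doubles, which is why the
  approximant is taken for \<open>e / 2\<close>.\<close>

lemma bounded_approx_continuous:
  fixes f :: "complex \<Rightarrow> 'b::{banach, second_countable_topology}"
  assumes [measurable]: "f \<in> borel_measurable circle" and C: "C > 0"
    and fC: "AE z in circle. norm (f z) \<le> C" and e: "e > 0"
  obtains c where "continuous_on (sphere 0 1) c" "\<And>z. norm (c z) \<le> C"
    "(\<integral>\<^sup>+z. norm (f z - c z) \<partial>circle) \<le> ennreal e"
proof -
  have "integrable circle f" using fC by (intro circle.integrable_const_bound) auto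
  from integrable_approx_continuous[OF this, of "e / 2"] e
  obtain c where c: "continuous_on (sphere 0 1) c"
    "(\<integral>\<^sup>+z. norm (f z - c z) \<partial>circle) \<le> ennreal (e / 2)" by auto
  \<comment> \<open>The denominator is at least \<open>C > 0\<close>, so this form of the retraction
    is continuous without a case split.\<close>
  define p where "p z = (C / max C (norm (c z))) *\<^sub>R c z" for z
  have mpos: "max C (norm (c z)) > 0" for z using C by simp
  have p: "continuous_on (sphere 0 1) p"
    unfolding p_def[abs_def] using c(1) mpos
    by (intro continuous_intros) (auto simp: less_imp_neq[symmetric])
  have pC: "norm (p z) \<le> C" for z
    using C by (auto simp: p_def max_def field_simps)
  have pc: "norm (c z - p z) = max 0 (norm (c z) - C)" for z
  proof -
    have "c z - p z = (1 - C / max C (norm (c z))) *\<^sub>R c z"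
      by (simp add: p_def scaleR_diff_left)
    then have "norm (c z - p z) = \<bar>1 - C / max C (norm (c z))\<bar> * norm (c z)" by simp
    then show ?thesis using C by (auto simp: max_def abs_if field_simps)
  qed
  note [measurable] = borel_measurable_circle_continuous[OF c(1)]
  have "(\<integral>\<^sup>+z. norm (f z - p z) \<partial>circle) \<le> (\<integral>\<^sup>+z. 2 * ennreal (norm (f z - c z)) \<partial>circle)"
  proof (rule nn_integral_mono_AE)
    show "AE z in circle. ennreal (norm (f z - p z)) \<le> 2 * ennreal (norm (f z - c z))"
      using fC
    proof eventually_elim
      fix z assume "norm (f z) \<le> C"
      then have "norm (c z - p z) \<le> norm (f z - c z)"
        using norm_triangle_ineq2[of "c z" "f z"] by (simp add: pc norm_minus_commute)
      then have "norm (f z - p z) \<le> 2 * norm (f z - c z)"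
        using norm_triangle_ineq[of "f z - c z" "c z - p z"] by simp
      then have "ennreal (norm (f z - p z)) \<le> ennreal (2 * norm (f z - c z))"
        by (rule ennreal_leI)
      then show "ennreal (norm (f z - p z)) \<le> 2 * ennreal (norm (f z - c z))"
        by (simp add: ennreal_mult)
    qed
  qed
  also have "\<dots> = 2 * (\<integral>\<^sup>+z. norm (f z - c z) \<partial>circle)" by (rule nn_integral_cmult) measurable
  also have "\<dots> \<le> 2 * ennreal (e / 2)" using c(2) by (rule mult_left_mono) simp
  also have "\<dots> = ennreal (2 * (e / 2))" using e by (subst ennreal_mult) auto
  finally show thesis using p pC by (intro that[of p]) auto
qed

section \<open>From closeness in L^1 to the norm \<alpha>\<close>

context symmetric_seminorm
begin

text \<open>Fix a test function \<open>b\<close> with bound \<open>S\<close>. Where \<open>f\<close>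
  and \<open>g\<close> differ by less than \<open>a\<close>, \<open>b\<close> is dominated by
  \<open>norm (g z) + a\<close>. On the remaining set \<open>E\<close> it is dominated by
  \<open>S\<close>, and \<open>E\<close> is so small that its indicator has norm at most
  \<open>a\<close>.\<close>

lemma vnorm_le_approx:
  fixes f :: "complex \<Rightarrow> 'b::{real_normed_vector, second_countable_topology}"
  assumes [measurable]: "f \<in> borel_measurable circle"
    and approx: "\<And>e. e > 0 \<Longrightarrow> \<exists>g\<in>borel_measurable circle. vnorm \<alpha> g \<le> B + ennreal e \<and>
        (\<integral>\<^sup>+z. norm (f z - g z) \<partial>circle) \<le> ennreal e"
  shows "vnorm \<alpha> f \<le> B"
proof (rule vnorm_least)
  fix b assume b: "b \<in> Linfty" and bf: "AE z in circle. norm (b z) \<le> norm (f z)"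
  obtain S where S: "0 \<le> S" and bS: "AE z in circle. norm (b z) \<le> S" using b by (rule LinftyE)
  note [measurable] = Linfty_measurable[OF b]
  show "ennreal (\<alpha> b) \<le> B"
  proof (rule ennreal_le_epsilon)
    fix e :: real assume e: "0 < e"
    \<comment> \<open>The error is \<open>a\<close> from the norm of \<open>g\<close>,
      \<open>a\<close> from the gap between \<open>f\<close> and \<open>g\<close>, and
      \<open>S * a\<close> from the exceptional set.\<close>
    define a where "a = e / (S + 2)"
    have a: "a > 0" "a * (S + 2) = e" using e S by (simp_all add: a_def)
    obtain d where d: "d > 0" and dE: "\<And>E. E \<in> sets circle \<Longrightarrow> measure circle E < d \<Longrightarrow>
      vnorm \<alpha> (indicator E :: complex \<Rightarrow> real) \<le> ennreal a"
      by (rule vnorm_small_indicator[OF a(1)]) blast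
    \<comment> \<open>By Markov's inequality at level \<open>a\<close>, L^1 distance
      \<open>a * d / 2\<close> leaves an exceptional set of measure at most
      \<open>d / 2\<close>.\<close>
    have "min a (a * d / 2) > 0" using a d by simp
    from approx[OF this] obtain g where [measurable]: "g \<in> borel_measurable circle"
      and g: "vnorm \<alpha> g \<le> B + ennreal (min a (a * d / 2))"
        "(\<integral>\<^sup>+z. norm (f z - g z) \<partial>circle) \<le> ennreal (min a (a * d / 2))" by auto
    define E where "E = {z \<in> space circle. a \<le> norm (f z - g z)}"
    have E [measurable]: "E \<in> sets circle" unfolding E_def by measurable
    have "measure circle E \<le> min a (a * d / 2) / a"
      unfolding E_def using g(2) a d by (intro circle_measure_norm_ge) auto
    also have "\<dots> \<le> (a * d / 2) / a" using a by (intro divide_right_mono) auto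
    also have "\<dots> < d" using a d by simp
    finally have vE: "vnorm \<alpha> (indicator E :: complex \<Rightarrow> real) \<le> ennreal a" using E by (intro dE)
    have "ennreal (\<alpha> b) \<le> vnorm \<alpha> b" by (rule vnorm_upper[OF b]) simp
    also have "\<dots> \<le> vnorm \<alpha> g + vnorm \<alpha> (\<lambda>z. a + S * indicator E z)"
    proof (rule vnorm_triangle)
      show "AE z in circle. norm (b z) \<le> norm (g z) + norm (a + S * indicator E z)"
        using bf bS AE_space
      proof eventually_elim
        fix z assume z: "norm (b z) \<le> norm (f z)" "norm (b z) \<le> S" "z \<in> space circle"
        show "norm (b z) \<le> norm (g z) + norm (a + S * indicator E z)"
        proof (cases "z \<in> E")
          case True
          have "0 \<le> norm (g z)" by simp
          moreover have "norm (a + S * indicator E z) = a + S" using True S a by simp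
          ultimately show ?thesis using z(2) a by linarith
        next
          case False
          then have "norm (f z - g z) < a" using z by (auto simp: E_def)
          then show ?thesis using z(1) False a norm_triangle_ineq2[of "f z" "g z"] by simp
        qed
      qed
    qed measurable
    also have "vnorm \<alpha> (\<lambda>z. a + S * indicator E z) \<le>
        vnorm \<alpha> (\<lambda>_. a) + vnorm \<alpha> (\<lambda>z. S * indicator E z :: real)"
      by (rule vnorm_triangle) (auto simp: abs_triangle_ineq)
    also have "vnorm \<alpha> (\<lambda>z::complex. a) \<le> ennreal a" using a by (intro vnorm_bound) auto
    also have "vnorm \<alpha> (\<lambda>z. S * indicator E z :: real) \<le> ennreal S * vnorm \<alpha> (indicator E :: _ \<Rightarrow> real)"
      using S by (intro vnorm_scale) (auto simp: abs_mult)
    also have "\<dots> \<le> ennreal S * ennreal a" using vE by (rule mult_left_mono) simp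
    also have "\<dots> = ennreal (S * a)" using S a by (simp add: ennreal_mult)
    also have "vnorm \<alpha> g \<le> B + ennreal a"
      using g(1) by (rule order_trans) (auto intro!: add_left_mono ennreal_leI)
    also have "B + ennreal a + (ennreal a + ennreal (S * a)) = B + ennreal (a * (S + 2))"
      using a S by (simp flip: ennreal_plus add: add.assoc) (simp add: algebra_simps)
    also have "\<dots> = B + ennreal e" by (simp add: a)
    finally show "ennreal (\<alpha> b) \<le> B + ennreal e" by (simp add: add_mono)
  qed
qed

text \<open>The approximant obeys the same bound as \<open>f\<close>, so their difference is at most
  \<open>2 * D\<close> on the small set where they are not close. Both norms are controlled by the
  same \<open>c\<close> because this lemma feeds the comparison of the L^1 norm with
  \<open>vnorm\<close>, when neither closeness can yet be deduced from the other.\<close>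

lemma bounded_approx_continuous_vnorm:
  fixes f :: "complex \<Rightarrow> 'b::{banach, second_countable_topology}"
  assumes [measurable]: "f \<in> borel_measurable circle"
    and fC: "AE z in circle. norm (f z) \<le> C" and e: "e > 0"
  obtains c where "continuous_on (sphere 0 1) c" "vnorm \<alpha> (\<lambda>z. f z - c z) \<le> ennreal e"
    "(\<integral>\<^sup>+z. norm (f z - c z) \<partial>circle) \<le> ennreal e"
proof -
  \<comment> \<open>The retraction used for bounded approximation asks for a positive
    radius.\<close>
  define D where "D = max 1 C"
  have D: "D > 0" and fD: "AE z in circle. norm (f z) \<le> D"
    using fC by (auto simp: D_def elim!: eventually_mono)
  \<comment> \<open>The total error is \<open>a\<close> off the exceptional set plus
    \<open>2 * D * a\<close> on it.\<close>
  define a where "a = e / (2 * D + 1)"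
  have a: "a > 0" "a * (2 * D + 1) = e" using e D by (simp_all add: a_def)
  obtain d where d: "d > 0" and dE: "\<And>E. E \<in> sets circle \<Longrightarrow> measure circle E < d \<Longrightarrow>
      vnorm \<alpha> (indicator E :: complex \<Rightarrow> real) \<le> ennreal a"
    by (rule vnorm_small_indicator[OF a(1)]) blast
  have "min e (a * d / 2) > 0" using a d e by simp
  from bounded_approx_continuous[OF _ D fD this] obtain c where
    c: "continuous_on (sphere 0 1) c" "\<And>z. norm (c z) \<le> D"
    "(\<integral>\<^sup>+z. norm (f z - c z) \<partial>circle) \<le> ennreal (min e (a * d / 2))" by auto
  note [measurable] = borel_measurable_circle_continuous[OF c(1)]
  define E where "E = {z \<in> space circle. a \<le> norm (f z - c z)}"
  have E [measurable]: "E \<in> sets circle" unfolding E_def by measurable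
  have "measure circle E \<le> min e (a * d / 2) / a"
    unfolding E_def using c(3) a d e by (intro circle_measure_norm_ge) auto
  also have "\<dots> \<le> (a * d / 2) / a" using a by (intro divide_right_mono) auto
  also have "\<dots> < d" using a d by simp
  finally have vE: "vnorm \<alpha> (indicator E :: complex \<Rightarrow> real) \<le> ennreal a" using E by (intro dE)
  have "vnorm \<alpha> (\<lambda>z. f z - c z) \<le> vnorm \<alpha> (\<lambda>z::complex. a) + vnorm \<alpha> (\<lambda>z. 2 * D * indicator E z)"
  proof (rule vnorm_triangle)
    show "AE z in circle. norm (f z - c z) \<le> norm a + norm (2 * D * indicator E z)"
      using fD AE_space
    proof eventually_elim
      fix z assume z: "norm (f z) \<le> D" "z \<in> space circle"
      show "norm (f z - c z) \<le> norm a + norm (2 * D * indicator E z)"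
        using z c(2)[of z] norm_triangle_ineq4[of "f z" "c z"] D a
        by (cases "z \<in> E") (auto simp: E_def)
    qed
  qed measurable
  also have "vnorm \<alpha> (\<lambda>z::complex. a) \<le> ennreal a" using a by (intro vnorm_bound) auto
  also have "vnorm \<alpha> (\<lambda>z. 2 * D * indicator E z) \<le> ennreal (2 * D) * vnorm \<alpha> (indicator E :: _ \<Rightarrow> real)"
    using D by (intro vnorm_scale) (auto simp: abs_mult)
  also have "\<dots> \<le> ennreal (2 * D) * ennreal a" using vE by (rule mult_left_mono) simp
  also have "ennreal a + \<dots> = ennreal (a * (2 * D + 1))"
    using a D by (simp flip: ennreal_plus ennreal_mult add: algebra_simps)
  also have "\<dots> = ennreal e" by (simp add: a)
  finally have "vnorm \<alpha> (\<lambda>z. f z - c z) \<le> ennreal e" by (simp add: add_mono)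
  moreover have "(\<integral>\<^sup>+z. norm (f z - c z) \<partial>circle) \<le> ennreal e"
    using c(3) by (rule order_trans) (simp add: ennreal_leI)
  ultimately show thesis using c(1) by (intro that)
qed

end

section \<open>Convolution\<close>


lemma borel_measurable_conv_integrand [measurable]:
  fixes f :: "complex \<Rightarrow> 'b::{banach, second_countable_topology}"
  assumes f: "f \<in> borel_measurable circle" and g: "g \<in> borel_measurable circle"
  shows "(\<lambda>p. g (snd p) *\<^sub>R f (cnj (snd p) * fst p)) \<in> borel_measurable (circle \<Otimes>\<^sub>M circle)"
  using measurable_compose[OF measurable_quotient f] measurable_compose[OF measurable_snd g]
  by (intro borel_measurable_scaleR)

lemma borel_measurable_conv [measurable]:
  fixes f :: "complex \<Rightarrow> 'b::{banach, second_countable_topology}"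
  assumes f: "f \<in> borel_measurable circle" and g: "g \<in> borel_measurable circle"
  shows "conv f g \<in> borel_measurable circle"
  unfolding conv_def[abs_def]
  using borel_measurable_conv_integrand[OF f g]
  by (intro circle.borel_measurable_lebesgue_integral) (simp add: case_prod_beta')

lemma borel_measurable_conv_section:
  fixes f :: "complex \<Rightarrow> 'b::{banach, second_countable_topology}"
  assumes f: "f \<in> borel_measurable circle" and g: "g \<in> borel_measurable circle"
    and z: "z \<in> sphere 0 1"
  shows "(\<lambda>w. g w *\<^sub>R f (cnj w * z)) \<in> borel_measurable circle"
  using measurable_compose[OF measurable_reflect[OF z] f] g
  by (intro borel_measurable_scaleR)

text \<open>Tonelli's theorem exchanges the integrals; for fixed \<open>w\<close> the integral over
  \<open>z\<close> is then freed of \<open>w\<close> by rotation invariance.\<close>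

lemma nn_integral_conv_integrand:
  fixes f :: "complex \<Rightarrow> 'b::{banach, second_countable_topology}"
  assumes f: "f \<in> borel_measurable circle" and g: "g \<in> borel_measurable circle"
  shows "(\<integral>\<^sup>+z. \<integral>\<^sup>+w. norm (g w *\<^sub>R f (cnj w * z)) \<partial>circle \<partial>circle) =
    (\<integral>\<^sup>+w. \<bar>g w\<bar> \<partial>circle) * (\<integral>\<^sup>+z. norm (f z) \<partial>circle)"
proof -
  note [measurable] = f g
  have int: "(\<lambda>p. ennreal (norm (g (snd p) *\<^sub>R f (cnj (snd p) * fst p))))
      \<in> borel_measurable (circle \<Otimes>\<^sub>M circle)"
    using borel_measurable_conv_integrand[OF f g] by (rule measurable_compose) simp
  have "(\<integral>\<^sup>+z. \<integral>\<^sup>+w. norm (g w *\<^sub>R f (cnj w * z)) \<partial>circle \<partial>circle) =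
      (\<integral>\<^sup>+w. \<integral>\<^sup>+z. norm (g w *\<^sub>R f (cnj w * z)) \<partial>circle \<partial>circle)"
    using circle_pair.Fubini[OF int, symmetric] by (simp del: norm_scaleR)
  also have "\<dots> = (\<integral>\<^sup>+w. \<bar>g w\<bar> * (\<integral>\<^sup>+z. norm (f z) \<partial>circle) \<partial>circle)"
  proof (rule nn_integral_cong)
    fix w assume "w \<in> space circle"
    then have w: "cnj w \<in> sphere 0 1" by simp
    have "(\<integral>\<^sup>+z. norm (g w *\<^sub>R f (cnj w * z)) \<partial>circle) =
        (\<integral>\<^sup>+z. ennreal \<bar>g w\<bar> * norm (f (cnj w * z)) \<partial>circle)"
      by (simp add: ennreal_mult)
    also have "\<dots> = \<bar>g w\<bar> * (\<integral>\<^sup>+z. norm (f (cnj w * z)) \<partial>circle)"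
      using measurable_compose[OF measurable_rotate[OF w] f] by (intro nn_integral_cmult) simp
    also have "(\<integral>\<^sup>+z. norm (f (cnj w * z)) \<partial>circle) = (\<integral>\<^sup>+z. norm (f z) \<partial>circle)"
      by (rule nn_integral_circle_rotate[OF _ w]) measurable
    finally show "(\<integral>\<^sup>+z. norm (g w *\<^sub>R f (cnj w * z)) \<partial>circle) =
        \<bar>g w\<bar> * (\<integral>\<^sup>+z. norm (f z) \<partial>circle)" .
  qed
  also have "\<dots> = (\<integral>\<^sup>+w. \<bar>g w\<bar> \<partial>circle) * (\<integral>\<^sup>+z. norm (f z) \<partial>circle)"
    by (rule nn_integral_multc) measurable
  finally show ?thesis .
qed

lemma conv_exists_integrable:
  fixes f :: "complex \<Rightarrow> 'b::{banach, second_countable_topology}"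
  assumes f: "integrable circle f" and g: "integrable circle g"
  shows "conv_exists f g"
proof -
  note fm = borel_measurable_integrable[OF f] and gm = borel_measurable_integrable[OF g]
  have "(\<integral>\<^sup>+z. \<integral>\<^sup>+w. norm (g w *\<^sub>R f (cnj w * z)) \<partial>circle \<partial>circle) \<noteq> \<infinity>"
    using f g unfolding nn_integral_conv_integrand[OF fm gm] integrable_iff_bounded
    by (auto simp: ennreal_mult_eq_top_iff)
  moreover have "(\<lambda>z. \<integral>\<^sup>+w. norm (g w *\<^sub>R f (cnj w * z)) \<partial>circle) \<in> borel_measurable circle"
    using measurable_compose[OF borel_measurable_conv_integrand[OF fm gm] borel_measurable_norm]
    by (intro circle.borel_measurable_nn_integral measurable_compose[OF _ measurable_ennreal])
       (simp add: case_prod_beta')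
  ultimately have "AE z in circle. (\<integral>\<^sup>+w. norm (g w *\<^sub>R f (cnj w * z)) \<partial>circle) \<noteq> \<infinity>"
    by (intro nn_integral_PInf_AE)
  with AE_space show ?thesis
    unfolding conv_exists_def
  proof eventually_elim
    fix z assume "z \<in> space circle" "(\<integral>\<^sup>+w. norm (g w *\<^sub>R f (cnj w * z)) \<partial>circle) \<noteq> \<infinity>"
    then show "integrable circle (\<lambda>w. g w *\<^sub>R f (cnj w * z))"
      using borel_measurable_conv_section[OF fm gm, of z]
      by (simp add: integrable_iff_bounded less_top)
  qed
qed

text \<open>Young's inequality for L^1, from the norm bound for the Bochner integral at almost every
  point.\<close>

lemma nn_integral_conv_le:
  fixes f :: "complex \<Rightarrow> 'b::{banach, second_countable_topology}"
  assumes f: "integrable circle f" and g: "integrable circle g"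
  shows "(\<integral>\<^sup>+z. norm (conv f g z) \<partial>circle) \<le>
    (\<integral>\<^sup>+w. \<bar>g w\<bar> \<partial>circle) * (\<integral>\<^sup>+z. norm (f z) \<partial>circle)"
proof -
  have "(\<integral>\<^sup>+z. norm (conv f g z) \<partial>circle) \<le>
      (\<integral>\<^sup>+z. \<integral>\<^sup>+w. norm (g w *\<^sub>R f (cnj w * z)) \<partial>circle \<partial>circle)"
  proof (rule nn_integral_mono_AE)
    show "AE z in circle. ennreal (norm (conv f g z)) \<le>
        (\<integral>\<^sup>+w. norm (g w *\<^sub>R f (cnj w * z)) \<partial>circle)"
      using conv_exists_integrable[OF f g] unfolding conv_exists_def
      by eventually_elim (simp add: conv_def integral_norm_bound_ennreal del: norm_scaleR)
  qed
  then show ?thesis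
    using f g by (simp add: nn_integral_conv_integrand del: norm_scaleR)
qed

text \<open>Linearity is claimed where both integrals exist. Elsewhere \<open>conv\<close> may take
  the default value 0, so the identity is restricted to almost every point.\<close>

lemma conv_diff:
  fixes f1 f2 :: "complex \<Rightarrow> 'b::{banach, second_countable_topology}"
  assumes "integrable circle f1" "integrable circle f2" "integrable circle g"
  shows "AE z in circle. conv f1 g z - conv f2 g z = conv (\<lambda>z. f1 z - f2 z) g z"
  using conv_exists_integrable[OF assms(1,3)] conv_exists_integrable[OF assms(2,3)]
  unfolding conv_exists_def
  by eventually_elim (simp add: conv_def scaleR_diff_right)

section \<open>Convolution of continuous functions\<close>

lemma continuous_circle_bounded:
  fixes c :: "complex \<Rightarrow> 'b::real_normed_vector"
  assumes "continuous_on (sphere 0 1) c"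
  obtains C where "C > 0" "\<And>z. z \<in> sphere 0 1 \<Longrightarrow> norm (c z) \<le> C"
proof -
  have "bounded (c ` sphere 0 1)"
    using assms by (intro compact_imp_bounded compact_continuous_image) auto
  then show thesis using that by (auto simp: bounded_pos)
qed

lemma integrable_continuous_circle:
  fixes c :: "complex \<Rightarrow> 'b::{banach, second_countable_topology}"
  assumes c: "continuous_on (sphere 0 1) c"
  shows "integrable circle c"
proof -
  obtain C where "\<And>z. z \<in> sphere 0 1 \<Longrightarrow> norm (c z) \<le> C"
    using c by (rule continuous_circle_bounded) blast
  then show ?thesis
    by (intro circle.integrable_const_bound[of _ C] borel_measurable_circle_continuous c AE_I2) auto
qed

text \<open>Boundedness of \<open>c\<close> makes a multiple of \<open>g\<close> a majorant. The
  convolution integral thus exists at every point of the circle, which permits pointwise estimates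
  with no exceptional set.\<close>

lemma integrable_conv_continuous:
  fixes c :: "complex \<Rightarrow> 'b::{banach, second_countable_topology}"
  assumes c: "continuous_on (sphere 0 1) c" and g: "integrable circle g" and z: "z \<in> sphere 0 1"
  shows "integrable circle (\<lambda>w. g w *\<^sub>R c (cnj w * z))"
proof -
  obtain C where C: "\<And>z. z \<in> sphere 0 1 \<Longrightarrow> norm (c z) \<le> C"
    using c by (rule continuous_circle_bounded) blast
  show ?thesis
  proof (rule Bochner_Integration.integrable_bound)
    show "integrable circle (\<lambda>w. C * g w)" using g by simp
    show "(\<lambda>w. g w *\<^sub>R c (cnj w * z)) \<in> borel_measurable circle"
      by (intro borel_measurable_conv_section borel_measurable_circle_continuous c
          borel_measurable_integrable g z)
    show "AE w in circle. norm (g w *\<^sub>R c (cnj w * z)) \<le> norm (C * g w)"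
    proof (rule AE_I2)
      fix w assume "w \<in> space circle"
      then have "norm (c (cnj w * z)) \<le> C" using z by (intro C) (simp add: norm_mult)
      then have "norm (c (cnj w * z)) \<le> \<bar>C\<bar>" by linarith
      then have "\<bar>g w\<bar> * norm (c (cnj w * z)) \<le> \<bar>g w\<bar> * \<bar>C\<bar>"
        by (rule mult_left_mono) simp
      then show "norm (g w *\<^sub>R c (cnj w * z)) \<le> norm (C * g w)"
        by (simp add: abs_mult mult.commute)
    qed
  qed
qed

text \<open>Convolution with the constant kernel replaces \<open>c\<close> by its mean; the
  contraction property for this kernel is thereby a bound on an integral.\<close>

lemma conv_one:
  fixes c :: "complex \<Rightarrow> 'b::{banach, second_countable_topology}"
  assumes c: "c \<in> borel_measurable circle" and z: "z \<in> sphere 0 1"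
  shows "conv c (\<lambda>_. 1) z = (LINT w|circle. c w)"
proof -
  have "(LINT w|circle. c w) = (LINT w|distr circle circle (\<lambda>w. cnj w * z). c w)"
    by (simp only: distr_circle_reflect[OF z])
  also have "\<dots> = (LINT w|circle. c (cnj w * z))"
    by (rule integral_distr[OF measurable_reflect[OF z] c])
  finally show ?thesis by (simp add: conv_def)
qed

section \<open>Contraction on continuous functions and domination of the L^1 norm\<close>

context symmetric_seminorm
begin

text \<open>Cutting the kernel into pieces supported on small discs compares the convolution with a
  combination of rotations of \<open>c\<close>.\<close>

lemma vnorm_conv_continuous_cover:
  fixes c :: "complex \<Rightarrow> 'b::{banach, second_countable_topology}"
  assumes c: "continuous_on (sphere 0 1) c" and e: "e > 0"
    and d: "\<And>x y. x \<in> sphere 0 1 \<Longrightarrow> y \<in> sphere 0 1 \<Longrightarrow> dist x y < d \<Longrightarrow> dist (c x) (c y) < e"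
    and F: "finite F" "F \<subseteq> sphere 0 1"
    and g: "integrable circle g" "AE w in circle. 0 \<le> g w"
    and supp: "\<And>w. w \<in> sphere 0 1 \<Longrightarrow> w \<notin> (\<Union>v\<in>F. ball v d) \<Longrightarrow> g w = 0"
  shows "vnorm \<alpha> (conv c g) \<le> (vnorm \<alpha> c + ennreal e) * ennreal (LINT w|circle. g w)"
  using F g supp
\<comment> \<open>The pieces of a probability density are no longer probability densities, so the
  bound is stated with the mass of the kernel. Masses of the pieces add up to the mass of
  \<open>g\<close>.\<close>
proof (induction F arbitrary: g)
  case empty
  have "AE z in circle. norm (conv c g z) \<le> 0"
  proof (rule AE_I2)
    fix z assume "z \<in> space circle"
    have "conv c g z = (LINT w|circle. 0)"
      unfolding conv_def using empty.prems(4) by (intro Bochner_Integration.integral_cong) auto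
    then show "norm (conv c g z) \<le> 0" by simp
  qed
  then have "vnorm \<alpha> (conv c g) \<le> ennreal 0" by (intro vnorm_bound) auto
  then show ?case by simp
next
  case (insert v F)
  note cm = borel_measurable_circle_continuous[OF c]
  have v: "v \<in> sphere 0 1" using insert.prems(1) by simp
  have ball: "ball v d \<inter> sphere 0 1 \<in> sets circle"
    by (auto simp: sets_circle sets_restrict_space)
  have m1 [measurable]: "(\<lambda>w. indicat_real (ball v d) w) \<in> borel_measurable circle"
    using ball by (subst borel_measurable_indicator_iff) (simp add: Int_commute)
  \<comment> \<open>\<open>g1\<close> lives on the disc around the new centre \<open>v\<close>. What
    is left, \<open>g2\<close>, vanishes outside the other discs and falls under the induction
    hypothesis.\<close>
  define g1 where "g1 w = indicat_real (ball v d) w * g w" for w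
  define g2 where "g2 w = (1 - indicat_real (ball v d) w) * g w" for w
  note gm [measurable] = borel_measurable_integrable[OF insert.prems(2)]
  have g1: "integrable circle g1" unfolding g1_def[abs_def]
    by (rule Bochner_Integration.integrable_bound[OF insert.prems(2)])
       (auto simp: indicator_def)
  have g2: "integrable circle g2" unfolding g2_def[abs_def]
    by (rule Bochner_Integration.integrable_bound[OF insert.prems(2)])
       (auto simp: indicator_def)
  have pos: "AE w in circle. 0 \<le> g1 w" "AE w in circle. 0 \<le> g2 w"
    using insert.prems(3) by (auto elim!: eventually_mono simp: g1_def g2_def indicator_def)
  note g1m = borel_measurable_integrable[OF g1] and g2m = borel_measurable_integrable[OF g2]
  have gsum: "g w = g1 w + g2 w" for w by (simp add: g1_def g2_def algebra_simps)
  have nn: "0 \<le> (LINT w|circle. g1 w)" "0 \<le> (LINT w|circle. g2 w)"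
    using pos by (auto intro: integral_nonneg_AE)
  have v2: "vnorm \<alpha> (conv c g2) \<le> (vnorm \<alpha> c + ennreal e) * ennreal (LINT w|circle. g2 w)"
  proof (rule insert.IH)
    show "g2 w = 0" if "w \<in> sphere 0 1" "w \<notin> (\<Union>v\<in>F. ball v d)" for w
      using insert.prems(4)[of w] that by (auto simp: g2_def indicator_def)
  qed (use insert.prems g2 pos in auto)
  \<comment> \<open>For \<open>w\<close> in the disc, \<open>cnj w * z\<close> and
    \<open>cnj v * z\<close> are less than \<open>d\<close> apart, so \<open>k z\<close> dominates
    all values of \<open>c\<close> that meet \<open>g1\<close>. Up to \<open>e\<close> it is a
    single rotation of \<open>norm (c z)\<close>.\<close>
  define k where "k z = norm (c (cnj v * z)) + e" for z
  have "vnorm \<alpha> (conv c g1) \<le> ennreal (LINT w|circle. g1 w) * vnorm \<alpha> k"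
  proof (rule vnorm_scale[OF AE_I2 nn(1)])
    fix z assume "z \<in> space circle"
    then have z: "z \<in> sphere 0 1" by simp
    have "norm (conv c g1 z) \<le> (LINT w|circle. norm (g1 w *\<^sub>R c (cnj w * z)))"
      unfolding conv_def by (rule integral_norm_bound)
    also have "\<dots> \<le> (LINT w|circle. g1 w * k z)"
    proof (rule integral_mono_AE)
      show "integrable circle (\<lambda>w. norm (g1 w *\<^sub>R c (cnj w * z)))"
        by (intro integrable_norm integrable_conv_continuous c g1 z)
      show "integrable circle (\<lambda>w. g1 w * k z)" using g1 by simp
      show "AE w in circle. norm (g1 w *\<^sub>R c (cnj w * z)) \<le> g1 w * k z"
        using pos(1) AE_space
      proof eventually_elim
        fix w assume w: "0 \<le> g1 w" "w \<in> space circle"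
        show "norm (g1 w *\<^sub>R c (cnj w * z)) \<le> g1 w * k z"
        proof (cases "w \<in> ball v d")
          case True
          have "dist (cnj w * z) (cnj v * z) = dist w v"
            using z by (simp add: dist_norm norm_mult flip: left_diff_distrib complex_cnj_diff)
          also have "\<dots> < d" using True by (simp add: dist_commute)
          finally have "dist (c (cnj w * z)) (c (cnj v * z)) < e"
            using w v z by (intro d) (auto simp: norm_mult)
          then have "norm (c (cnj w * z)) \<le> k z"
            using norm_triangle_ineq2[of "c (cnj w * z)" "c (cnj v * z)"]
            by (simp add: k_def dist_norm)
          then show ?thesis using w(1) by (simp add: mult_left_mono)
        qed (simp add: g1_def)
      qed
    qed
    also have "\<dots> = (LINT w|circle. g1 w) * k z" by simp
    also have "\<dots> = (LINT w|circle. g1 w) * norm (k z)" using e by (simp add: k_def)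
    finally show "norm (conv c g1 z) \<le> (LINT w|circle. g1 w) * norm (k z)" .
  qed
  also have "vnorm \<alpha> k \<le> vnorm \<alpha> c + ennreal e"
  proof -
    have "vnorm \<alpha> k \<le> vnorm \<alpha> (\<lambda>z. c (cnj v * z)) + vnorm \<alpha> (\<lambda>z::complex. e)"
      using measurable_compose[OF measurable_rotate cm, of "cnj v"] v e
      by (intro vnorm_triangle) (auto simp: k_def)
    also have "\<dots> \<le> vnorm \<alpha> c + ennreal e"
      using v e by (intro add_mono vnorm_rotate vnorm_bound) auto
    finally show ?thesis .
  qed
  finally have v1: "vnorm \<alpha> (conv c g1) \<le> ennreal (LINT w|circle. g1 w) * (vnorm \<alpha> c + ennreal e)"
    by (simp add: mult_left_mono)
  have "vnorm \<alpha> (conv c g) \<le> vnorm \<alpha> (conv c g1) + vnorm \<alpha> (conv c g2)"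
  proof (rule vnorm_triangle[OF borel_measurable_conv[OF cm g1m] AE_I2])
    fix z assume "z \<in> space circle"
    then have z: "z \<in> sphere 0 1" by simp
    have "conv c g z = conv c g1 z + conv c g2 z"
      unfolding conv_def
      by (subst Bochner_Integration.integral_add[symmetric])
         (auto simp: gsum scaleR_add_left intro!: integrable_conv_continuous c g1 g2 z[simplified])
    then show "norm (conv c g z) \<le> norm (conv c g1 z) + norm (conv c g2 z)"
      by (simp add: norm_triangle_ineq)
  qed
  also have "\<dots> \<le> (vnorm \<alpha> c + ennreal e) *
      (ennreal (LINT w|circle. g1 w) + ennreal (LINT w|circle. g2 w))"
    using add_mono[OF v1 v2] by (simp add: distrib_left mult.commute)
  also have "ennreal (LINT w|circle. g1 w) + ennreal (LINT w|circle. g2 w) =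
      ennreal (LINT w|circle. g w)"
    using nn g1 g2 by (simp add: gsum flip: ennreal_plus)
  finally show ?case .
qed

text \<open>Uniform continuity provides the radius for a tolerance \<open>e\<close>, and compactness
  of the circle a finite set of centres. The mass of the kernel is 1, so only the error
  \<open>e\<close> remains.\<close>

lemma vnorm_conv_continuous:
  fixes c :: "complex \<Rightarrow> 'b::{banach, second_countable_topology}"
  assumes c: "continuous_on (sphere 0 1) c"
    and g: "integrable circle g" "AE w in circle. 0 \<le> g w" "(LINT w|circle. g w) = 1"
  shows "vnorm \<alpha> (conv c g) \<le> vnorm \<alpha> c"
proof (rule ennreal_le_epsilon)
  fix e :: real assume e: "0 < e"
  have "uniformly_continuous_on (sphere 0 1) c"
    using c by (rule compact_uniformly_continuous) simp
  then obtain d where d: "d > 0" "\<And>x y. x \<in> sphere 0 1 \<Longrightarrow> y \<in> sphere 0 1 \<Longrightarrow> dist x y < d \<Longrightarrow>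
      dist (c x) (c y) < e"
    using e unfolding uniformly_continuous_on_def by blast
  obtain F where F: "F \<subseteq> sphere 0 1" "finite F" "sphere (0::complex) 1 \<subseteq> (\<Union>v\<in>F. ball v d)"
    by (rule compactE_image[of "sphere (0::complex) 1" "sphere 0 1" "\<lambda>v. ball v d"])
       (use d(1) in \<open>auto intro!: bexI simp del: mem_sphere\<close>)
  have "vnorm \<alpha> (conv c g) \<le> (vnorm \<alpha> c + ennreal e) * ennreal (LINT w|circle. g w)"
    using F(3) by (intro vnorm_conv_continuous_cover[OF c e d(2) F(2,1) g(1,2)]) auto
  then show "vnorm \<alpha> (conv c g) \<le> vnorm \<alpha> c + ennreal e" by (simp add: g(3))
qed

text \<open>For nonnegative \<open>h\<close> the L^1 norm is the mean. The mean of a continuous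
  approximant \<open>c\<close>, viewed as a constant function, is its convolution with the kernel 1
  and so has norm at most \<open>vnorm \<alpha> c\<close>. Passing from \<open>h\<close> to
  \<open>c\<close> costs \<open>e / 2\<close> in the L^1 norm and \<open>e / 2\<close> in
  \<open>vnorm\<close>.\<close>

lemma nn_integral_le_vnorm_bounded:
  fixes h :: "complex \<Rightarrow> real"
  assumes [measurable]: "h \<in> borel_measurable circle"
    and h0: "\<And>z. 0 \<le> h z" and hC: "\<And>z. h z \<le> C"
  shows "(\<integral>\<^sup>+z. h z \<partial>circle) \<le> vnorm \<alpha> h"
proof (rule ennreal_le_epsilon)
  fix e :: real assume e: "0 < e"
  have "AE z in circle. norm (h z) \<le> C" "e / 2 > 0" using h0 hC e by auto
  from bounded_approx_continuous_vnorm[OF assms(1) this]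
  obtain c where c: "continuous_on (sphere 0 1) c" "vnorm \<alpha> (\<lambda>z. h z - c z) \<le> ennreal (e / 2)"
    "(\<integral>\<^sup>+z. norm (h z - c z) \<partial>circle) \<le> ennreal (e / 2)" by blast
  note cm [measurable] = borel_measurable_circle_continuous[OF c(1)]
  have hi: "integrable circle h" using h0 hC by (intro circle.integrable_const_bound[of _ C]) auto
  have ci: "integrable circle c" by (rule integrable_continuous_circle[OF c(1)])
  have "ennreal \<bar>LINT z|circle. c z\<bar> \<le> vnorm \<alpha> (\<lambda>z::complex. LINT z|circle. c z)"
    using vnorm_const[of "LINT z|circle. c z"] by simp
  also have "\<dots> \<le> vnorm \<alpha> (conv c (\<lambda>_. 1))"
    by (rule vnorm_mono, rule AE_I2) (simp add: conv_one[OF cm])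
  also have "\<dots> \<le> vnorm \<alpha> c"
    using circle.prob_space by (intro vnorm_conv_continuous c(1)) auto
  also have "\<dots> \<le> vnorm \<alpha> (\<lambda>z. h z - c z) + vnorm \<alpha> h"
    by (rule vnorm_triangle) auto
  also have "\<dots> \<le> ennreal (e / 2) + vnorm \<alpha> h" using c(2) by (rule add_right_mono)
  finally have A: "ennreal \<bar>LINT z|circle. c z\<bar> \<le> ennreal (e / 2) + vnorm \<alpha> h" .
  have "(\<integral>\<^sup>+z. h z \<partial>circle) \<le> (\<integral>\<^sup>+z. norm (h z - c z) \<partial>circle) + ennreal \<bar>LINT z|circle. c z\<bar>"
  proof -
    have "(LINT z|circle. h z) = (LINT z|circle. h z - c z) + (LINT z|circle. c z)"
      using hi ci by simp
    also have "\<dots> \<le> (LINT z|circle. norm (h z - c z)) + \<bar>LINT z|circle. c z\<bar>"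
      using integral_norm_bound[of circle "\<lambda>z. h z - c z"]
      by (intro add_mono) (simp_all add: abs_le_iff)
    finally have "ennreal (LINT z|circle. h z) \<le>
        ennreal (LINT z|circle. norm (h z - c z)) + ennreal \<bar>LINT z|circle. c z\<bar>"
      by (simp add: ennreal_leI flip: ennreal_plus)
    then show ?thesis using hi ci h0 by (simp add: nn_integral_eq_integral)
  qed
  also have "\<dots> \<le> ennreal (e / 2) + (ennreal (e / 2) + vnorm \<alpha> h)"
    using c(3) A by (rule add_mono)
  also have "\<dots> = vnorm \<alpha> h + (ennreal (e / 2) + ennreal (e / 2))" by (simp add: ac_simps)
  also have "ennreal (e / 2) + ennreal (e / 2) = ennreal e" using e by (simp flip: ennreal_plus)
  finally show "(\<integral>\<^sup>+z. h z \<partial>circle) \<le> vnorm \<alpha> h + ennreal e" .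
qed

text \<open>The modulus is truncated at height \<open>n\<close>; monotone convergence on the left
  meets monotonicity of \<open>vnorm\<close> on the right.\<close>

lemma nn_integral_le_vnorm:
  fixes f :: "complex \<Rightarrow> 'b::{real_normed_vector, second_countable_topology}"
  assumes [measurable]: "f \<in> borel_measurable circle"
  shows "(\<integral>\<^sup>+z. norm (f z) \<partial>circle) \<le> vnorm \<alpha> f"
proof -
  have SUPm: "(SUP n. ennreal (min (norm (f z)) (real n))) = ennreal (norm (f z))" for z
  proof (rule antisym)
    obtain n :: nat where "norm (f z) \<le> real n" using real_arch_simple by blast
    then have "ennreal (norm (f z)) = ennreal (min (norm (f z)) (real n))" by (simp add: min_def)
    also have "\<dots> \<le> (SUP n. ennreal (min (norm (f z)) (real n)))" by (rule SUP_upper) simp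
    finally show "ennreal (norm (f z)) \<le> (SUP n. ennreal (min (norm (f z)) (real n)))" .
  qed (auto intro!: SUP_least ennreal_leI)
  have "(\<integral>\<^sup>+z. norm (f z) \<partial>circle) = (\<integral>\<^sup>+z. (SUP n. ennreal (min (norm (f z)) (real n))) \<partial>circle)"
    by (simp only: SUPm)
  also have "\<dots> = (SUP n. \<integral>\<^sup>+z. min (norm (f z)) (real n) \<partial>circle)"
    by (rule nn_integral_monotone_convergence_SUP)
       (auto simp: incseq_def le_fun_def intro!: ennreal_leI)
  also have "\<dots> \<le> vnorm \<alpha> f"
  proof (rule SUP_least)
    fix n
    have "(\<integral>\<^sup>+z. min (norm (f z)) (real n) \<partial>circle) \<le> vnorm \<alpha> (\<lambda>z. min (norm (f z)) (real n))"
      by (rule nn_integral_le_vnorm_bounded[of _ "real n"]) auto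
    also have "\<dots> \<le> vnorm \<alpha> f" by (rule vnorm_mono) auto
    finally show "(\<integral>\<^sup>+z. min (norm (f z)) (real n) \<partial>circle) \<le> vnorm \<alpha> f" .
  qed
  finally show ?thesis .
qed

end

section \<open>Convolution and approximate identities in \<open>L\<^sup>\<alpha>\<close>\<close>


context symmetric_seminorm
begin

lemma vnorm_of_real_norm: "vnorm \<alpha> (\<lambda>z. complex_of_real (norm (f z))) = vnorm \<alpha> f"
  by (simp add: vnorm_def)

lemma Lalpha_vec_iff:
  fixes f :: "complex \<Rightarrow> 'b::{real_normed_vector, second_countable_topology}"
  shows "f \<in> Lalpha_vec \<alpha> \<longleftrightarrow> f \<in> borel_measurable circle \<and> vnorm \<alpha> f < \<infinity> \<and>
    (\<forall>e>0. \<exists>g\<in>Linfty. vnorm \<alpha> (\<lambda>z. complex_of_real (norm (f z)) - g z) < ennreal e)"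
  by (auto simp: Lalpha_vec_def Lalpha_def Lfin_def ext_eq_vnorm vnorm_of_real_norm)

text \<open>Where \<open>\<bar>f\<bar>\<close> exceeds twice a bound for \<open>g\<close>, it is at most \<open>2 \<bar>\<bar>f\<bar> - g\<bar>\<close>, so the tails of
  \<open>f\<close> are small.\<close>

lemma Lalpha_vec_approx_bounded:
  fixes f :: "complex \<Rightarrow> 'b::{real_normed_vector, second_countable_topology}"
  assumes f: "f \<in> Lalpha_vec \<alpha>" and e: "e > 0"
  obtains b C where "b \<in> borel_measurable circle" "\<And>z. norm (b z) \<le> C"
    "vnorm \<alpha> (\<lambda>z. f z - b z) \<le> ennreal e"
proof -
  have [measurable]: "f \<in> borel_measurable circle" using f by (simp add: Lalpha_vec_iff)
  have "e / 2 > 0" using e by simp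
  then obtain g where g: "g \<in> Linfty"
    "vnorm \<alpha> (\<lambda>z. complex_of_real (norm (f z)) - g z) < ennreal (e / 2)"
    using f unfolding Lalpha_vec_iff by blast
  obtain C where C: "0 \<le> C" "AE z in circle. norm (g z) \<le> C" using g(1) by (rule LinftyE)
  define b where "b z = (if norm (f z) \<le> 2 * C then f z else 0)" for z
  have "vnorm \<alpha> (\<lambda>z. f z - b z) \<le> ennreal 2 * vnorm \<alpha> (\<lambda>z. complex_of_real (norm (f z)) - g z)"
  proof (rule vnorm_scale)
    show "AE z in circle. norm (f z - b z) \<le> 2 * norm (complex_of_real (norm (f z)) - g z)"
      using C(2)
    proof eventually_elim
      fix z assume z: "norm (g z) \<le> C"
      show "norm (f z - b z) \<le> 2 * norm (complex_of_real (norm (f z)) - g z)"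
        using z norm_triangle_ineq2[of "complex_of_real (norm (f z))" "g z"]
        by (cases "norm (f z) \<le> 2 * C") (auto simp: b_def)
    qed
  qed simp
  also have "\<dots> \<le> ennreal 2 * ennreal (e / 2)" using g(2) by (intro mult_left_mono) auto
  also have "\<dots> = ennreal e" using e by (subst ennreal_mult[symmetric]) auto
  finally have "vnorm \<alpha> (\<lambda>z. f z - b z) \<le> ennreal e" .
  moreover have "b \<in> borel_measurable circle" by (simp add: b_def[abs_def])
  moreover have "norm (b z) \<le> 2 * C" for z using C(1) by (simp add: b_def)
  ultimately show thesis by (intro that[of b "2 * C"])
qed

text \<open>\<open>Lalpha_vec\<close> is defined by scalar approximation of the modulus. Bounded
  vector-valued approximants \<open>b\<close> of \<open>f\<close> suffice, since the moduli of
  \<open>f\<close> and \<open>b\<close> differ by at most \<open>norm (f z - b z)\<close>.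
  Finiteness of the norm comes from one approximant with error 1.\<close>

lemma Lalpha_vecI:
  fixes f :: "complex \<Rightarrow> 'b::{real_normed_vector, second_countable_topology}"
  assumes f [measurable]: "f \<in> borel_measurable circle"
    and approx: "\<And>e. e > 0 \<Longrightarrow> \<exists>b\<in>borel_measurable circle. \<exists>C. (AE z in circle. norm (b z) \<le> C) \<and>
        vnorm \<alpha> (\<lambda>z. f z - b z) \<le> ennreal e"
  shows "f \<in> Lalpha_vec \<alpha>"
  unfolding Lalpha_vec_iff
proof (intro conjI allI impI f)
  obtain b C where b [measurable]: "b \<in> borel_measurable circle"
    and C: "AE z in circle. norm (b z) \<le> C" and fb: "vnorm \<alpha> (\<lambda>z. f z - b z) \<le> ennreal 1"
    using approx[of 1] by auto
  have C0: "AE z in circle. norm (b z) \<le> max 0 C" using C by eventually_elim simp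
  have "vnorm \<alpha> f \<le> vnorm \<alpha> (\<lambda>z. f z - b z) + vnorm \<alpha> b"
  proof (rule vnorm_triangle)
    show "AE z in circle. norm (f z) \<le> norm (f z - b z) + norm (b z)"
      using norm_triangle_ineq[of "f z - b z" "b z" for z] by auto
  qed measurable
  also have "\<dots> \<le> ennreal 1 + ennreal (max 0 C)"
    by (rule add_mono[OF fb vnorm_bound[OF _ C0]]) simp
  also have "\<dots> < \<infinity>" by (simp add: less_top)
  finally show "vnorm \<alpha> f < \<infinity>" .
next
  fix e :: real assume e: "e > 0"
  obtain b C where b [measurable]: "b \<in> borel_measurable circle"
    and C: "AE z in circle. norm (b z) \<le> C" and fb: "vnorm \<alpha> (\<lambda>z. f z - b z) \<le> ennreal (e / 2)"
    using approx[of "e / 2"] e by auto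
  show "\<exists>g\<in>Linfty. vnorm \<alpha> (\<lambda>z. complex_of_real (norm (f z)) - g z) < ennreal e"
  proof (rule bexI)
    show "(\<lambda>z. complex_of_real (norm (b z))) \<in> Linfty"
      using C by (intro LinftyI[of _ C]) auto
    have "vnorm \<alpha> (\<lambda>z. complex_of_real (norm (f z)) - complex_of_real (norm (b z))) \<le>
        vnorm \<alpha> (\<lambda>z. f z - b z)"
      by (rule vnorm_mono, rule AE_I2)
         (simp add: norm_of_real norm_triangle_ineq3 flip: of_real_diff)
    also have "\<dots> \<le> ennreal (e / 2)" by (rule fb)
    also have "\<dots> < ennreal e" using e by (simp add: ennreal_less_iff)
    finally show "vnorm \<alpha> (\<lambda>z. complex_of_real (norm (f z)) - complex_of_real (norm (b z))) < ennreal e" .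
  qed
qed

lemma Lalpha_vec_integrable:
  fixes f :: "complex \<Rightarrow> 'b::{banach, second_countable_topology}"
  assumes "f \<in> Lalpha_vec \<alpha>"
  shows "integrable circle f"
proof -
  have "f \<in> borel_measurable circle" "vnorm \<alpha> f < \<infinity>" using assms by (simp_all add: Lalpha_vec_iff)
  then show ?thesis
    using nn_integral_le_vnorm[of f] by (simp add: integrable_iff_bounded le_less_trans)
qed

lemma Lalpha_vec_approx_continuous:
  fixes f :: "complex \<Rightarrow> 'b::{banach, second_countable_topology}"
  assumes f: "f \<in> Lalpha_vec \<alpha>" and e: "e > 0"
  obtains c where "continuous_on (sphere 0 1) c" "vnorm \<alpha> (\<lambda>z. f z - c z) \<le> ennreal e"
proof -
  have e2: "e / 2 > 0" using e by simp
  have [measurable]: "f \<in> borel_measurable circle" using f by (simp add: Lalpha_vec_iff)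
  obtain b C where b [measurable]: "b \<in> borel_measurable circle"
    and C: "\<And>z. norm (b z) \<le> C" and fb: "vnorm \<alpha> (\<lambda>z. f z - b z) \<le> ennreal (e / 2)"
    using f e2 by (rule Lalpha_vec_approx_bounded) blast
  obtain c where c: "continuous_on (sphere 0 1) c" "vnorm \<alpha> (\<lambda>z. b z - c z) \<le> ennreal (e / 2)"
    using C by (rule bounded_approx_continuous_vnorm[OF b AE_I2 e2]) blast
  note [measurable] = borel_measurable_circle_continuous[OF c(1)]
  have "vnorm \<alpha> (\<lambda>z. f z - c z) \<le> vnorm \<alpha> (\<lambda>z. f z - b z) + vnorm \<alpha> (\<lambda>z. b z - c z)"
    by (rule vnorm_triangle) (auto intro: norm_diff_triangle_le)
  also have "\<dots> \<le> ennreal (e / 2) + ennreal (e / 2)" using fb c(2) by (rule add_mono)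
  also have "\<dots> = ennreal e" using e by (simp flip: ennreal_plus)
  finally show thesis using c(1) by (intro that)
qed

text \<open>Continuous functions are bounded on the circle, so approximants of \<open>f\<close> can
  be shifted by \<open>c\<close>. The lemma serves to apply the contraction bound to
  \<open>f - c\<close>.\<close>

lemma Lalpha_vec_diff_continuous:
  fixes f :: "complex \<Rightarrow> 'b::{banach, second_countable_topology}"
  assumes f: "f \<in> Lalpha_vec \<alpha>" and c: "continuous_on (sphere 0 1) c"
  shows "(\<lambda>z. f z - c z) \<in> Lalpha_vec \<alpha>"
proof (rule Lalpha_vecI)
  have fm [measurable]: "f \<in> borel_measurable circle" using f by (simp add: Lalpha_vec_iff)
  note [measurable] = borel_measurable_circle_continuous[OF c]
  show "(\<lambda>z. f z - c z) \<in> borel_measurable circle" by measurable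
  fix e :: real assume e: "e > 0"
  obtain d where d: "continuous_on (sphere 0 1) d" "vnorm \<alpha> (\<lambda>z. f z - d z) \<le> ennreal e"
    using f e by (rule Lalpha_vec_approx_continuous)
  have dc: "continuous_on (sphere 0 1) (\<lambda>z. d z - c z)" using d(1) c by (rule continuous_on_diff)
  obtain C where "\<And>z. z \<in> sphere 0 1 \<Longrightarrow> norm (d z - c z) \<le> C"
    using dc by (rule continuous_circle_bounded) blast
  then have "AE z in circle. norm (d z - c z) \<le> C" by (intro AE_I2) simp
  moreover have "vnorm \<alpha> (\<lambda>z. f z - c z - (d z - c z)) \<le> ennreal e" using d(2) by simp
  ultimately show "\<exists>b\<in>borel_measurable circle. \<exists>C. (AE z in circle. norm (b z) \<le> C) \<and>
      vnorm \<alpha> (\<lambda>z. f z - c z - b z) \<le> ennreal e"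
    using borel_measurable_circle_continuous[OF dc]
    by (intro bexI[of _ "\<lambda>z. d z - c z"] exI[of _ C] conjI)
qed

text \<open>The approximants of \<open>conv f g\<close> are \<open>conv c g\<close> with
  \<open>c\<close> continuous and close to \<open>f\<close>. Their norms are controlled by the
  continuous case, their L^1 distance from \<open>conv f g\<close> by Young's inequality and the
  domination of the L^1 norm by \<open>vnorm\<close>.\<close>

lemma vnorm_conv_le:
  fixes f :: "complex \<Rightarrow> 'b::{banach, second_countable_topology}"
  assumes f: "f \<in> Lalpha_vec \<alpha>"
    and g: "integrable circle g" "AE w in circle. 0 \<le> g w" "(LINT w|circle. g w) = 1"
  shows "vnorm \<alpha> (conv f g) \<le> vnorm \<alpha> f"
proof (rule vnorm_le_approx)
  have fi: "integrable circle f" using f by (rule Lalpha_vec_integrable)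
  note fm [measurable] = borel_measurable_integrable[OF fi]
  note gm = borel_measurable_integrable[OF g(1)]
  show "conv f g \<in> borel_measurable circle" using fm gm by (rule borel_measurable_conv)
  have g1: "(\<integral>\<^sup>+w. \<bar>g w\<bar> \<partial>circle) = 1"
  proof -
    have "(\<integral>\<^sup>+w. \<bar>g w\<bar> \<partial>circle) = (\<integral>\<^sup>+w. g w \<partial>circle)"
      using g(2) by (intro nn_integral_cong_AE) (auto elim!: eventually_mono)
    then show ?thesis using g by (simp add: nn_integral_eq_integral)
  qed
  fix e :: real assume e: "e > 0"
  obtain c where c: "continuous_on (sphere 0 1) c" "vnorm \<alpha> (\<lambda>z. f z - c z) \<le> ennreal e"
    using f e by (rule Lalpha_vec_approx_continuous)
  note cm [measurable] = borel_measurable_circle_continuous[OF c(1)]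
  have ci: "integrable circle c" by (rule integrable_continuous_circle[OF c(1)])
  have "vnorm \<alpha> (conv c g) \<le> vnorm \<alpha> c" using c(1) g by (rule vnorm_conv_continuous)
  also have "\<dots> \<le> vnorm \<alpha> f + vnorm \<alpha> (\<lambda>z. f z - c z)"
  proof (rule vnorm_triangle)
    show "AE z in circle. norm (c z) \<le> norm (f z) + norm (f z - c z)"
      using norm_triangle_sub[of "c z" "f z" for z] by (auto simp: norm_minus_commute)
  qed measurable
  also have "\<dots> \<le> vnorm \<alpha> f + ennreal e" using c(2) by (rule add_left_mono)
  finally have A: "vnorm \<alpha> (conv c g) \<le> vnorm \<alpha> f + ennreal e" .
  have "(\<integral>\<^sup>+z. norm (conv f g z - conv c g z) \<partial>circle) =
      (\<integral>\<^sup>+z. norm (conv (\<lambda>z. f z - c z) g z) \<partial>circle)"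
    using conv_diff[OF fi ci g(1)] by (intro nn_integral_cong_AE) (auto elim!: eventually_mono)
  also have "\<dots> \<le> (\<integral>\<^sup>+z. norm (f z - c z) \<partial>circle)"
    using nn_integral_conv_le[OF Bochner_Integration.integrable_diff[OF fi ci] g(1)] by (simp add: g1)
  also have "\<dots> \<le> vnorm \<alpha> (\<lambda>z. f z - c z)" by (rule nn_integral_le_vnorm) measurable
  also have "\<dots> \<le> ennreal e" by (rule c(2))
  finally show "\<exists>h\<in>borel_measurable circle. vnorm \<alpha> h \<le> vnorm \<alpha> f + ennreal e \<and>
      (\<integral>\<^sup>+z. norm (conv f g z - h z) \<partial>circle) \<le> ennreal e"
    using A borel_measurable_conv[OF cm gm] by blast
qed

lemma vnorm_conv_diff_le:
  fixes f :: "complex \<Rightarrow> 'b::{banach, second_countable_topology}"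
  assumes f: "f \<in> Lalpha_vec \<alpha>" and c: "continuous_on (sphere 0 1) c"
    and g: "integrable circle g" "AE w in circle. 0 \<le> g w" "(LINT w|circle. g w) = 1"
  shows "vnorm \<alpha> (\<lambda>z. conv f g z - conv c g z) \<le> vnorm \<alpha> (\<lambda>z. f z - c z)"
proof -
  have "vnorm \<alpha> (\<lambda>z. conv f g z - conv c g z) \<le> vnorm \<alpha> (conv (\<lambda>z. f z - c z) g)"
    using conv_diff[OF Lalpha_vec_integrable[OF f] integrable_continuous_circle[OF c] g(1)]
    by (intro vnorm_mono) (auto elim!: eventually_mono)
  also have "\<dots> \<le> vnorm \<alpha> (\<lambda>z. f z - c z)"
    using Lalpha_vec_diff_continuous[OF f c] g by (rule vnorm_conv_le)
  finally show ?thesis .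
qed

text \<open>\<open>conv c g\<close> with \<open>c\<close> continuous is bounded by any bound of
  \<open>c\<close>, because \<open>g\<close> is a probability density. It approximates
  \<open>conv f g\<close> by the contraction bound for \<open>f - c\<close>.\<close>

lemma conv_Lalpha_vec:
  fixes f :: "complex \<Rightarrow> 'b::{banach, second_countable_topology}"
  assumes f: "f \<in> Lalpha_vec \<alpha>"
    and g: "integrable circle g" "AE w in circle. 0 \<le> g w" "(LINT w|circle. g w) = 1"
  shows "conv f g \<in> Lalpha_vec \<alpha>"
proof (rule Lalpha_vecI)
  note gm = borel_measurable_integrable[OF g(1)]
  have fm: "f \<in> borel_measurable circle" using f by (simp add: Lalpha_vec_iff)
  show "conv f g \<in> borel_measurable circle" using fm gm by (rule borel_measurable_conv)
  fix e :: real assume e: "e > 0"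
  obtain c where c: "continuous_on (sphere 0 1) c" "vnorm \<alpha> (\<lambda>z. f z - c z) \<le> ennreal e"
    using f e by (rule Lalpha_vec_approx_continuous)
  note cm = borel_measurable_circle_continuous[OF c(1)]
  have "vnorm \<alpha> (\<lambda>z. conv f g z - conv c g z) \<le> ennreal e"
    using vnorm_conv_diff_le[OF f c(1) g] c(2) by (rule order_trans)
  moreover obtain C where C: "\<And>z. z \<in> sphere 0 1 \<Longrightarrow> norm (c z) \<le> C"
    using c(1) by (rule continuous_circle_bounded) blast
  have "AE z in circle. norm (conv c g z) \<le> C"
  proof (rule AE_I2)
    fix z assume "z \<in> space circle"
    then have z: "z \<in> sphere 0 1" by simp
    have "norm (conv c g z) \<le> (LINT w|circle. norm (g w *\<^sub>R c (cnj w * z)))"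
      unfolding conv_def by (rule integral_norm_bound)
    also have "\<dots> \<le> (LINT w|circle. g w * C)"
    proof (rule integral_mono_AE)
      show "integrable circle (\<lambda>w. norm (g w *\<^sub>R c (cnj w * z)))"
        by (intro integrable_norm integrable_conv_continuous c(1) g(1) z)
      show "AE w in circle. norm (g w *\<^sub>R c (cnj w * z)) \<le> g w * C"
        using g(2) AE_space
      proof eventually_elim
        fix w assume "0 \<le> g w" "w \<in> space circle"
        with z show "norm (g w *\<^sub>R c (cnj w * z)) \<le> g w * C"
          by (auto simp: norm_mult intro!: mult_left_mono C)
      qed
    qed (use g(1) in simp)
    also have "\<dots> = C" using g(3) by simp
    finally show "norm (conv c g z) \<le> C" .
  qed
  ultimately show "\<exists>b\<in>borel_measurable circle. \<exists>C. (AE z in circle. norm (b z) \<le> C) \<and>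
      vnorm \<alpha> (\<lambda>z. conv f g z - b z) \<le> ennreal e"
    using borel_measurable_conv[OF cm gm] by blast
qed

end

text \<open>The integral of \<open>c z - c (cnj w * z)\<close> against the kernel is split at a
  neighbourhood \<open>U\<close> of 1. For \<open>w\<close> in \<open>U\<close> the difference is
  small by uniform continuity and the kernel has mass 1; for \<open>w\<close> outside
  \<open>U\<close> the kernel is small and the difference is at most \<open>2 * C\<close>. Neither
  estimate depends on \<open>z\<close>.\<close>

lemma approximate_identity_uniform:
  fixes c :: "complex \<Rightarrow> 'b::{banach, second_countable_topology}"
  assumes \<phi>: "approximate_identity I le \<phi>" and c: "continuous_on (sphere 0 1) c" and e: "e > 0"
  shows "\<forall>\<^sub>F l in net_filter I le. \<forall>z\<in>sphere 0 1. norm (c z - conv c (\<phi> l) z) \<le> e"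
proof -
  obtain C where C: "C > 0" "\<And>z. z \<in> sphere 0 1 \<Longrightarrow> norm (c z) \<le> C"
    using c by (rule continuous_circle_bounded) blast
  have "uniformly_continuous_on (sphere 0 1) c"
    using c by (rule compact_uniformly_continuous) simp
  moreover have "e / 2 > 0" using e by simp
  ultimately obtain d where d: "d > 0" "\<And>x y. x \<in> sphere 0 1 \<Longrightarrow> y \<in> sphere 0 1 \<Longrightarrow> dist y x < d \<Longrightarrow>
      dist (c y) (c x) < e / 2"
    unfolding uniformly_continuous_on_def by blast
  define U where "U = sphere (0::complex) 1 \<inter> ball 1 d"
  \<comment> \<open>Chosen so that the part outside \<open>U\<close> contributes at most
    \<open>2 * C * \<eta> = e / 2\<close>.\<close>
  define \<eta> where "\<eta> = e / (4 * C)"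
  have \<eta>: "\<eta> > 0" "2 * C * \<eta> = e / 2" using e C by (simp_all add: \<eta>_def)
  have "openin (top_of_set (sphere 0 1)) U" "1 \<in> U"
    using d(1) by (auto simp: U_def intro!: openin_open_Int)
  then have ev: "\<forall>\<^sub>F l in net_filter I le. AE z in circle. z \<in> sphere 0 1 - U \<longrightarrow> \<bar>\<phi> l z\<bar> < \<eta>"
    using \<phi> \<eta>(1) unfolding approximate_identity_def by blast
  have dir: "directed_on I le" using \<phi> by (simp add: approximate_identity_def)
  have main: "norm (c z - conv c (\<phi> l) z) \<le> e"
    if l: "l \<in> I" and small: "AE z in circle. z \<in> sphere 0 1 - U \<longrightarrow> \<bar>\<phi> l z\<bar> < \<eta>"
      and z: "z \<in> sphere 0 1" for l z
  proof -
    have g: "integrable circle (\<phi> l)" "AE z in circle. 0 \<le> \<phi> l z" "(LINT z|circle. \<phi> l z) = 1"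
      using \<phi> l by (auto simp: approximate_identity_def)
    have ci: "integrable circle (\<lambda>w. \<phi> l w *\<^sub>R c z)" using g(1) by simp
    have cv: "integrable circle (\<lambda>w. \<phi> l w *\<^sub>R c (cnj w * z))"
      by (rule integrable_conv_continuous[OF c g(1) z])
    \<comment> \<open>Since the kernel has integral 1, \<open>c z\<close> is itself the integral of
      \<open>\<phi> l w *\<^sub>R c z\<close>.\<close>
    have "c z - conv c (\<phi> l) z = (LINT w|circle. \<phi> l w *\<^sub>R c z - \<phi> l w *\<^sub>R c (cnj w * z))"
      using ci cv g(1,3) by (simp add: conv_def)
    also have "norm \<dots> \<le> (LINT w|circle. norm (\<phi> l w *\<^sub>R c z - \<phi> l w *\<^sub>R c (cnj w * z)))"
      by (rule integral_norm_bound)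
    \<comment> \<open>The sum of the two nonnegative bounds is a majorant both in and outside
      \<open>U\<close>, so the domain of integration is not split.\<close>
    also have "\<dots> \<le> (LINT w|circle. \<phi> l w * (e / 2) + 2 * C * \<eta>)"
    proof (rule integral_mono_AE)
      show "integrable circle (\<lambda>w. norm (\<phi> l w *\<^sub>R c z - \<phi> l w *\<^sub>R c (cnj w * z)))"
        using ci cv by simp
      show "integrable circle (\<lambda>w. \<phi> l w * (e / 2) + 2 * C * \<eta>)" using g(1) by simp
      show "AE w in circle. norm (\<phi> l w *\<^sub>R c z - \<phi> l w *\<^sub>R c (cnj w * z)) \<le>
          \<phi> l w * (e / 2) + 2 * C * \<eta>"
        using g(2) small AE_space
      proof eventually_elim
        fix w assume w: "0 \<le> \<phi> l w" "w \<in> sphere 0 1 - U \<longrightarrow> \<bar>\<phi> l w\<bar> < \<eta>" "w \<in> space circle"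
        then have wz: "cnj w * z \<in> sphere 0 1" using z by (simp add: norm_mult)
        have eq: "norm (\<phi> l w *\<^sub>R c z - \<phi> l w *\<^sub>R c (cnj w * z)) = \<phi> l w * dist (c z) (c (cnj w * z))"
          using w(1) by (simp add: dist_norm flip: scaleR_diff_right)
        show "norm (\<phi> l w *\<^sub>R c z - \<phi> l w *\<^sub>R c (cnj w * z)) \<le> \<phi> l w * (e / 2) + 2 * C * \<eta>"
        proof (cases "w \<in> U")
          case True
          have "z - cnj w * z = cnj (1 - w) * z" by (simp add: algebra_simps)
          then have "dist z (cnj w * z) = dist 1 w"
            using z by (simp add: dist_norm norm_mult del: complex_cnj_diff)
          also have "\<dots> < d" using True by (simp add: U_def)
          finally have "dist (c z) (c (cnj w * z)) < e / 2" using wz z by (intro d) auto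
          then have "\<phi> l w * dist (c z) (c (cnj w * z)) \<le> \<phi> l w * (e / 2)"
            using w(1) by (intro mult_left_mono) auto
          moreover have "0 \<le> 2 * C * \<eta>" using C \<eta> by simp
          ultimately show ?thesis unfolding eq by linarith
        next
          case False
          then have "\<phi> l w \<le> \<eta>" using w by auto
          moreover have "dist (c z) (c (cnj w * z)) \<le> 2 * C"
            using norm_triangle_ineq4[of "c z" "c (cnj w * z)"] C(2)[OF z] C(2)[OF wz]
            by (simp add: dist_norm)
          ultimately have "\<phi> l w * dist (c z) (c (cnj w * z)) \<le> \<eta> * (2 * C)"
            using \<eta> by (intro mult_mono) auto
          moreover have "0 \<le> \<phi> l w * (e / 2)" using w(1) e by simp
          ultimately show ?thesis unfolding eq by (simp add: mult.commute)
        qed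
      qed
    qed
    also have "\<dots> = e / 2 + 2 * C * \<eta>"
      using g(1,3) circle.prob_space by simp
    also have "\<dots> = e" by (simp add: \<eta>)
    finally show ?thesis .
  qed
  from ev obtain a where "a \<in> I" "\<forall>l\<in>I. le a l \<longrightarrow>
      (AE z in circle. z \<in> sphere 0 1 - U \<longrightarrow> \<bar>\<phi> l z\<bar> < \<eta>)"
    unfolding eventually_net_filter[OF dir] by blast
  with main show ?thesis unfolding eventually_net_filter[OF dir] by blast
qed

theorem theorem5p7:
  fixes \<alpha> :: "(complex \<Rightarrow> complex) \<Rightarrow> real"
    and f :: "complex \<Rightarrow> 'a::{banach, second_countable_topology}"
    and I :: "'i set" and le :: "'i \<Rightarrow> 'i \<Rightarrow> bool"
    and \<phi> :: "'i \<Rightarrow> complex \<Rightarrow> real"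
  assumes "\<alpha> \<in> Rc"
    and "f \<in> Lalpha_vec \<alpha>"
    and "approximate_identity I le \<phi>"
  shows "(\<forall>l\<in>I. conv_exists f (\<phi> l) \<and> conv f (\<phi> l) \<in> Lalpha_vec \<alpha> \<and>
                 vnorm \<alpha> (conv f (\<phi> l)) \<le> vnorm \<alpha> f) \<and>
         ((\<lambda>l. vnorm \<alpha> (\<lambda>z. f z - conv f (\<phi> l) z)) \<longlongrightarrow> 0) (net_filter I le)"
proof -
  interpret symmetric_seminorm \<alpha> using assms(1) by unfold_locales
  note f = assms(2)
  have dir: "directed_on I le" using assms(3) by (simp add: approximate_identity_def)
  have \<phi>: "integrable circle (\<phi> l)" "AE z in circle. 0 \<le> \<phi> l z" "(LINT z|circle. \<phi> l z) = 1"
    if "l \<in> I" for l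
    using assms(3) that by (auto simp: approximate_identity_def)
  have fi: "integrable circle f" using f by (rule Lalpha_vec_integrable)
  note fm [measurable] = borel_measurable_integrable[OF fi]
  have small: "\<forall>\<^sub>F l in net_filter I le. vnorm \<alpha> (\<lambda>z. f z - conv f (\<phi> l) z) \<le> ennreal e"
    if e: "e > 0" for e :: real
  proof -
    \<comment> \<open>The three errors are \<open>f - c\<close>, then
      \<open>c - conv c (\<phi> l)\<close>, and finally the difference of
      \<open>conv f (\<phi> l)\<close> and \<open>conv c (\<phi> l)\<close>, which the contraction
      bound reduces to the first.\<close>
    have e3: "e / 3 > 0" using e by simp
    obtain c where c: "continuous_on (sphere 0 1) c" "vnorm \<alpha> (\<lambda>z. f z - c z) \<le> ennreal (e / 3)"
      using f e3 by (rule Lalpha_vec_approx_continuous)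
    note cm [measurable] = borel_measurable_circle_continuous[OF c(1)]
    have bd: "vnorm \<alpha> (\<lambda>z. f z - conv f (\<phi> l) z) \<le> ennreal e"
      if l: "l \<in> I" and u: "\<forall>z\<in>sphere 0 1. norm (c z - conv c (\<phi> l) z) \<le> e / 3" for l
    proof -
      note pm [measurable] = borel_measurable_integrable[OF \<phi>(1)[OF l]]
      note [measurable] = borel_measurable_conv[OF cm pm] borel_measurable_conv[OF fm pm]
      have "vnorm \<alpha> (\<lambda>z. f z - conv f (\<phi> l) z) \<le>
          vnorm \<alpha> (\<lambda>z. f z - c z) + vnorm \<alpha> (\<lambda>z. c z - conv f (\<phi> l) z)"
        by (rule vnorm_triangle) (auto intro: norm_diff_triangle_le)
      also have "vnorm \<alpha> (\<lambda>z. c z - conv f (\<phi> l) z) \<le>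
          vnorm \<alpha> (\<lambda>z. c z - conv c (\<phi> l) z) + vnorm \<alpha> (\<lambda>z. conv f (\<phi> l) z - conv c (\<phi> l) z)"
      proof (rule vnorm_triangle)
        show "AE z in circle. norm (c z - conv f (\<phi> l) z) \<le>
            norm (c z - conv c (\<phi> l) z) + norm (conv f (\<phi> l) z - conv c (\<phi> l) z)"
          using norm_triangle_ineq4[of "c z - conv c (\<phi> l) z" "conv f (\<phi> l) z - conv c (\<phi> l) z" for z]
          by simp
      qed measurable
      also have "vnorm \<alpha> (\<lambda>z. c z - conv c (\<phi> l) z) \<le> ennreal (e / 3)"
        using u e by (intro vnorm_bound) auto
      also have "vnorm \<alpha> (\<lambda>z. conv f (\<phi> l) z - conv c (\<phi> l) z) \<le> ennreal (e / 3)"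
        using vnorm_conv_diff_le[OF f c(1) \<phi>[OF l]] c(2) by (rule order_trans)
      also note c(2)
      also have "ennreal (e / 3) + (ennreal (e / 3) + ennreal (e / 3)) = ennreal e"
        using e by (simp flip: ennreal_plus)
      finally show ?thesis by (simp add: add_mono)
    qed
    from approximate_identity_uniform[OF assms(3) c(1) e3] obtain a where "a \<in> I"
      "\<forall>l\<in>I. le a l \<longrightarrow> (\<forall>z\<in>sphere 0 1. norm (c z - conv c (\<phi> l) z) \<le> e / 3)"
      unfolding eventually_net_filter[OF dir] by blast
    with bd show ?thesis unfolding eventually_net_filter[OF dir] by blast
  qed
  have "((\<lambda>l. vnorm \<alpha> (\<lambda>z. f z - conv f (\<phi> l) z)) \<longlongrightarrow> 0) (net_filter I le)"
  \<comment> \<open>The bound \<open>b\<close> may be infinite. A positive real \<open>e\<close>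
    strictly below it gives \<open>small\<close> a real tolerance and turns its weak inequality into
    a strict one.\<close>
  proof (rule order_tendstoI)
    fix b :: ennreal assume "0 < b"
    then obtain x where x: "0 < x" "x < b" using dense by blast
    then obtain e where e: "x = ennreal e" "e > 0"
      by (cases x) (auto simp: ennreal_less_zero_iff)
    show "\<forall>\<^sub>F l in net_filter I le. vnorm \<alpha> (\<lambda>z. f z - conv f (\<phi> l) z) < b"
      using small[OF e(2)] x(2) by (auto elim!: eventually_mono simp: e(1))
  qed simp
  moreover have "conv_exists f (\<phi> l)" "conv f (\<phi> l) \<in> Lalpha_vec \<alpha>"
    "vnorm \<alpha> (conv f (\<phi> l)) \<le> vnorm \<alpha> f" if "l \<in> I" for l
    using conv_exists_integrable[OF fi \<phi>(1)[OF that]] conv_Lalpha_vec[OF f \<phi>[OF that]]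
      vnorm_conv_le[OF f \<phi>[OF that]] by blast+
  ultimately show ?thesis by blast
qed

end
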